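(* Let $\mathcal{X}=\ell_1$ (over the complex scalars). A bounded linear operator $T\in\mathcal{L}(\mathcal{X})$ is a commutator if and only if $T-\lambda I$ is not compact for any scalar $\lambda\neq 0$.
   Context: $\mathcal{L}(\mathcal{X})$ denotes the Banach algebra of all bounded linear operators on $\mathcal{X}$ and $I$ the identity. An operator $T\in\mathcal{L}(\mathcal{X})$ is a commutator if $T=AB-BA$ for some $A,B\in\mathcal{L}(\mathcal{X})$. *)

theory Defs
  imports "HOL-Analysis.Analysis"
begin

typedef ell1 = "{x :: nat \<Rightarrow> complex. summable (\<lambda>n. norm (x n))}"
  morphisms coord Abs_ell1
  by (rule exI[of _ "\<lambda>_. 0"]) simp

setup_lifting type_definition_ell1

lemma summable_coord: "summable (\<lambda>n. norm (coord x n))"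
  using coord[of x] by simp

lemma summable_norm_add:
  fixes x y :: "nat \<Rightarrow> complex"
  assumes "summable (\<lambda>n. norm (x n))" "summable (\<lambda>n. norm (y n))"
  shows "summable (\<lambda>n. norm (x n + y n))"
  by (rule summable_comparison_test'[OF summable_add[OF assms], of 0])
     (simp add: norm_triangle_ineq)

lemma summable_norm_mult:
  fixes x :: "nat \<Rightarrow> complex"
  assumes "summable (\<lambda>n. norm (x n))"
  shows "summable (\<lambda>n. norm (c * x n))"
  using summable_mult[OF assms, of "norm c"] by (simp add: norm_mult)

instantiation ell1 :: real_normed_vector
begin

lift_definition zero_ell1 :: ell1 is "\<lambda>_. 0" by simp

lift_definition plus_ell1 :: "ell1 \<Rightarrow> ell1 \<Rightarrow> ell1" is "\<lambda>x y n. x n + y n"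
  by (rule summable_norm_add)

lift_definition uminus_ell1 :: "ell1 \<Rightarrow> ell1" is "\<lambda>x n. - x n" by simp

lift_definition minus_ell1 :: "ell1 \<Rightarrow> ell1 \<Rightarrow> ell1" is "\<lambda>x y n. x n - y n"
  using summable_norm_add[of _ "\<lambda>n. - _ n"] by simp

lift_definition scaleR_ell1 :: "real \<Rightarrow> ell1 \<Rightarrow> ell1" is "\<lambda>r x n. of_real r * x n"
  by (rule summable_norm_mult)

lift_definition norm_ell1 :: "ell1 \<Rightarrow> real" is "\<lambda>x. \<Sum>n. norm (x n)" .

definition sgn_ell1 :: "ell1 \<Rightarrow> ell1" where
  "sgn_ell1 x = inverse (norm x) *\<^sub>R x"

definition dist_ell1 :: "ell1 \<Rightarrow> ell1 \<Rightarrow> real" where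
  "dist_ell1 x y = norm (x - y)"

definition uniformity_ell1 :: "(ell1 \<times> ell1) filter" where
  "uniformity_ell1 = (INF e\<in>{0 <..}. principal {(x, y). dist x y < e})"

definition open_ell1 :: "ell1 set \<Rightarrow> bool" where
  "open_ell1 U \<longleftrightarrow> (\<forall>x\<in>U. \<forall>\<^sub>F (x', y) in uniformity. x' = x \<longrightarrow> y \<in> U)"

instance
proof
  fix x y z :: ell1 and a b :: real
  show "x + y + z = x + (y + z)" "x + y = y + x" "0 + x = x" "- x + x = 0" "x - y = x + - y"
    by (transfer; simp add: algebra_simps)+
  show "a *\<^sub>R (x + y) = a *\<^sub>R x + a *\<^sub>R y" "(a + b) *\<^sub>R x = a *\<^sub>R x + b *\<^sub>R x"
    "a *\<^sub>R b *\<^sub>R x = (a * b) *\<^sub>R x" "1 *\<^sub>R x = x"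
    by (transfer; simp add: algebra_simps)+
  show "norm x = 0 \<longleftrightarrow> x = 0"
    by transfer (auto simp: suminf_eq_zero_iff fun_eq_iff)
  show "norm (x + y) \<le> norm x + norm y"
  proof transfer
    fix x y :: "nat \<Rightarrow> complex"
    assume *: "summable (\<lambda>n. norm (x n))" "summable (\<lambda>n. norm (y n))"
    have "(\<Sum>n. norm (x n + y n)) \<le> (\<Sum>n. norm (x n) + norm (y n))"
      by (intro suminf_le summable_norm_add summable_add * norm_triangle_ineq)
    then show "(\<Sum>n. norm (x n + y n)) \<le> (\<Sum>n. norm (x n)) + (\<Sum>n. norm (y n))"
      by (simp add: suminf_add *)
  qed
  show "norm (a *\<^sub>R x) = \<bar>a\<bar> * norm x"
    by transfer (simp add: norm_mult suminf_mult)
qed (simp_all add: sgn_ell1_def dist_ell1_def uniformity_ell1_def open_ell1_def)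

end

text \<open>
  The instance above provides only the underlying real normed space (and hence the topology);
  the complex scalar multiplication is the following operation.
\<close>

lift_definition scaleC :: "complex \<Rightarrow> ell1 \<Rightarrow> ell1" (infixr "*\<^sub>C" 75) is "\<lambda>c x n. c * x n"
  by (rule summable_norm_mult)

lemma norm_scaleC: "norm (c *\<^sub>C x) = norm c * norm x"
  by transfer (simp add: norm_mult suminf_mult)

lemma scaleC_of_real: "of_real r *\<^sub>C x = r *\<^sub>R x"
  by transfer simp

text \<open>The library's bounded linearity is over the reals, so complex homogeneity is added.\<close>

definition bounded_clinear :: "(ell1 \<Rightarrow> ell1) \<Rightarrow> bool" where
  "bounded_clinear T \<longleftrightarrow> bounded_linear T \<and> (\<forall>c x. T (c *\<^sub>C x) = c *\<^sub>C T x)"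

definition commutator :: "(ell1 \<Rightarrow> ell1) \<Rightarrow> bool" where
  "commutator T \<longleftrightarrow>
     (\<exists>A B. bounded_clinear A \<and> bounded_clinear B \<and> T = (\<lambda>x. A (B x) - B (A x)))"

definition compact_operator :: "(ell1 \<Rightarrow> ell1) \<Rightarrow> bool" where
  "compact_operator K \<longleftrightarrow> bounded_clinear K \<and> compact (closure (K ` cball 0 1))"

end

theory Submission
  imports Defs "HOL-Complex_Analysis.Great_Picard"
begin

text \<open>
  Operators on \<open>\<ell>\<^sub>1\<close> are exactly the matrices with uniformly bounded columns, and the norm is the
  supremum of the column norms. All constructions below therefore define operators by prescribing
  their columns (\<open>cols\<close>), and identities between operators are checked on unit vectors.

  A commutator cannot be \<open>c I + K\<close> with \<open>c \<noteq> 0\<close> and \<open>K\<close> compact by Wielandt's argument in the quotient by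
  the compact operators. The quotient seminorm is realised concretely as the limit of the norms of
  the row tails of the matrix, \<open>ess_norm\<close>; it vanishes exactly on the compact operators. If
  \<open>A B - B A = c I + K\<close>, then \<open>A B\<^sup>n - B\<^sup>n A\<close> agrees with \<open>n c B\<^sup>n\<^sup>-\<^sup>1\<close> up to a compact operator, so the
  seminorm of \<open>B\<^sup>n\<^sup>-\<^sup>1\<close> is at most a constant over \<open>n\<close> times that of \<open>B\<^sup>n\<close>; this forces a power of \<open>B\<close>,
  and then, descending, \<open>B\<^sup>0 = I\<close>, to have seminorm \<open>0\<close>.

  Conversely, there are two sources of commutators. First, if infinitely many columns of \<open>T\<close> tend to
  \<open>0\<close> in norm, then \<open>T = F - R F L\<close> for a pair of shifts with \<open>L R = I\<close> and a bounded \<open>F\<close>, and this is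
  the commutator of \<open>L\<close> and \<open>R F\<close> (\<open>commutator_null_columns\<close>). Second, a \<open>2 \<times> 2\<close> operator matrix is a
  commutator as soon as its diagonal entries are, because the off-diagonal entries can be produced
  by solving Sylvester equations (\<open>commutator_diagonal\<close>). If the lower left entry maps infinitely
  many unit vectors onto the unit vector basis, a block triangular similarity makes infinitely many
  columns vanish in each diagonal entry, and both become commutators of the first kind
  (\<open>commutator_shift_corner\<close>). A gliding hump argument produces such a corner whenever infinitely
  many columns \<open>T e\<close> converge to \<open>0\<close> in each coordinate but stay away from the multiples of \<open>e\<close>
  (\<open>commutator_gliding_hump\<close>). Up to similarity, the unit vectors here may be replaced by
  perturbed ones (\<open>perturbed_units\<close>).

  Given any \<open>T\<close>, a diagonal argument provides differences \<open>u\<close> of unit vectors with \<open>T u\<close>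
  coordinatewise null. Either the vectors \<open>T u\<close> stay away from the multiples of \<open>u\<close> infinitely often,
  and \<open>T\<close> is a commutator; or \<open>T u - \<mu> u\<close> tends to \<open>0\<close> in norm along a subsequence. If \<open>\<mu> = 0\<close>, then \<open>T\<close>
  has null columns after a similarity. If \<open>\<mu> \<noteq> 0\<close>, the operator \<open>K = T - \<mu> I\<close> is not compact, and there
  are differences \<open>f\<close> with \<open>K f\<close> coordinatewise null but bounded below. The vectors \<open>u + f\<close> are then
  moved by \<open>K\<close> essentially to \<open>K f\<close>, which has a negligible component at the leading coordinate of \<open>u\<close>
  and so is not near a multiple of \<open>u + f\<close>. This is again the gliding hump situation.
\<close>

section \<open>The space\<close>

lemma coord_simps [simp]:
  "coord 0 i = 0" "coord (x + y) i = coord x i + coord y i"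
  "coord (x - y) i = coord x i - coord y i" "coord (- x) i = - coord x i"
  "coord (r *\<^sub>R x) i = of_real r * coord x i" "coord (c *\<^sub>C x) i = c * coord x i"
  by (transfer; simp)+

lemma ell1_eqI: "(\<And>i. coord x i = coord y i) \<Longrightarrow> x = y"
  by (metis coord_inject ext)

lemma norm_eq_suminf: "norm x = (\<Sum>i. norm (coord x i))"
  by transfer simp

lemma scaleC_simps [simp]:
  "c *\<^sub>C (x + y) = c *\<^sub>C x + c *\<^sub>C y" "c *\<^sub>C (x - y) = c *\<^sub>C x - c *\<^sub>C y"
  "c *\<^sub>C (- x) = - (c *\<^sub>C x)" "c *\<^sub>C d *\<^sub>C x = (c * d) *\<^sub>C x" "1 *\<^sub>C x = x"
  "0 *\<^sub>C x = 0" "c *\<^sub>C 0 = 0"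
  by (rule ell1_eqI, simp add: algebra_simps)+

lemma scaleC_add_left: "(c + d) *\<^sub>C x = c *\<^sub>C x + d *\<^sub>C x"
  and scaleC_diff_left: "(c - d) *\<^sub>C x = c *\<^sub>C x - d *\<^sub>C x"
  and scaleC_minus_left: "(- c) *\<^sub>C x = - (c *\<^sub>C x)"
  and scaleC_scaleR: "c *\<^sub>C r *\<^sub>R x = r *\<^sub>R c *\<^sub>C x"
  by (rule ell1_eqI, simp add: algebra_simps)+

lemma sum_norm_coord_le: "finite F \<Longrightarrow> (\<Sum>i\<in>F. norm (coord x i)) \<le> norm x"
  unfolding norm_eq_suminf by (rule sum_le_suminf) (auto simp: summable_coord)

lemma norm_coord_le: "norm (coord x i) \<le> norm x"
  using sum_norm_coord_le[of "{i}" x] by simp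

lemma norm_leI: "(\<And>n. (\<Sum>i<n. norm (coord x i)) \<le> C) \<Longrightarrow> norm x \<le> C"
  unfolding norm_eq_suminf by (rule suminf_le_const[OF summable_coord])

lemma coord_Abs_ell1:
  assumes "\<And>n. (\<Sum>i<n. norm (z i)) \<le> C"
  shows "coord (Abs_ell1 z) i = z i"
proof -
  have "summable (\<lambda>i. norm (z i))"
    using assms by (intro summableI_nonneg_bounded) auto
  then show ?thesis by (simp add: Abs_ell1_inverse)
qed

lemma bounded_linear_coord: "bounded_linear (\<lambda>x. coord x i)"
  by (rule bounded_linear_intro[of _ 1])
     (auto simp: norm_coord_le scaleR_conv_of_real)

lemma bounded_linear_scaleC: "bounded_linear (\<lambda>x. c *\<^sub>C x)"
  by (rule bounded_linear_intro[of _ "norm c"])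
     (auto simp: norm_scaleC scaleC_scaleR)

instance ell1 :: banach
proof
  fix X :: "nat \<Rightarrow> ell1"
  assume X: "Cauchy X"
  have "Cauchy (\<lambda>k. coord (X k) i)" for i
    by (rule bounded_linear.Cauchy[OF bounded_linear_coord X])
  then have "\<forall>i. \<exists>l. (\<lambda>k. coord (X k) i) \<longlonglongrightarrow> l"
    using Cauchy_convergent convergent_def by blast
  then obtain z where z: "\<And>i. (\<lambda>k. coord (X k) i) \<longlonglongrightarrow> z i" by metis
  \<comment> \<open>The Cauchy estimate survives in every finite section, uniformly in its length.\<close>
  have fin: "(\<Sum>i<n. norm (coord (X k) i - z i)) \<le> e"
    if N: "\<And>k l. k \<ge> N \<Longrightarrow> l \<ge> N \<Longrightarrow> norm (X k - X l) < e" and k: "k \<ge> N" for N k n e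
  proof (rule tendsto_upperbound)
    show "(\<lambda>l. \<Sum>i<n. norm (coord (X k) i - coord (X l) i))
            \<longlonglongrightarrow> (\<Sum>i<n. norm (coord (X k) i - z i))"
      by (intro tendsto_intros z)
    show "\<forall>\<^sub>F l in sequentially. (\<Sum>i<n. norm (coord (X k) i - coord (X l) i)) \<le> e"
    proof (rule eventually_sequentiallyI[of N])
      fix l assume "N \<le> l"
      have "(\<Sum>i<n. norm (coord (X k - X l) i)) \<le> norm (X k - X l)"
        by (rule sum_norm_coord_le) simp
      also have "\<dots> \<le> e" using N[OF k \<open>N \<le> l\<close>] by simp
      finally show "(\<Sum>i<n. norm (coord (X k) i - coord (X l) i)) \<le> e" by simp
    qed
  qed simp
  obtain N1 where N1: "\<And>k l. k \<ge> N1 \<Longrightarrow> l \<ge> N1 \<Longrightarrow> norm (X k - X l) < 1"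
    using X unfolding Cauchy_iff by (metis zero_less_one)
  have "(\<Sum>i<n. norm (z i)) \<le> norm (X N1) + 1" for n
  proof -
    have "(\<Sum>i<n. norm (z i)) \<le> (\<Sum>i<n. norm (coord (X N1) i) + norm (coord (X N1) i - z i))"
      by (intro sum_mono) (metis norm_minus_commute norm_triangle_sub)
    also have "\<dots> \<le> norm (X N1) + 1"
      using fin[where N = N1 and k = N1 and e = 1 and n = n] N1 sum_norm_coord_le[of "{..<n}" "X N1"]
      by (simp add: sum.distrib)
    finally show ?thesis .
  qed
  then have cz: "coord (Abs_ell1 z) i = z i" for i by (rule coord_Abs_ell1)
  have "X \<longlonglongrightarrow> Abs_ell1 z"
  proof (rule LIMSEQ_I)
    fix r :: real assume "0 < r"
    then obtain N where N: "\<And>k l. k \<ge> N \<Longrightarrow> l \<ge> N \<Longrightarrow> norm (X k - X l) < r / 2"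
      using X unfolding Cauchy_iff by (metis half_gt_zero)
    have "norm (X k - Abs_ell1 z) \<le> r / 2" if "k \<ge> N" for k
      using fin[OF N that] by (intro norm_leI) (simp add: cz)
    then show "\<exists>N. \<forall>k\<ge>N. norm (X k - Abs_ell1 z) < r"
      using \<open>0 < r\<close> by (intro exI[of _ N]) fastforce
  qed
  then show "convergent X" by (auto simp: convergent_def)
qed

lift_definition basis :: "nat \<Rightarrow> ell1" is "\<lambda>j i. if i = j then 1 else 0"
  by (rule summable_finite[of "{_}"]) auto

lift_definition restr :: "nat set \<Rightarrow> ell1 \<Rightarrow> ell1" is "\<lambda>A x i. if i \<in> A then x i else 0"
  by (rule summable_comparison_test') auto

lemma coord_basis [simp]: "coord (basis j) i = (if i = j then 1 else 0)"
  by transfer simp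

lemma coord_restr [simp]: "coord (restr A x) i = (if i \<in> A then coord x i else 0)"
  by transfer simp

lemma norm_basis [simp]: "norm (basis j) = 1"
proof -
  have "(\<Sum>i. norm (coord (basis j) i)) = (\<Sum>i\<in>{j}. norm (coord (basis j) i))"
    by (rule suminf_finite) auto
  then show ?thesis by (simp add: norm_eq_suminf)
qed

lemma restr_basis [simp]: "restr A (basis j) = (if j \<in> A then basis j else 0)"
  by (rule ell1_eqI) auto

lemma restr_singleton: "restr {j} x = coord x j *\<^sub>C basis j"
  by (rule ell1_eqI) auto

lemma norm_restr_Un:
  assumes "A \<inter> B = {}"
  shows "norm (restr (A \<union> B) x) = norm (restr A x) + norm (restr B x)"
proof -
  have "norm (coord (restr (A \<union> B) x) i) =
        norm (coord (restr A x) i) + norm (coord (restr B x) i)" for i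
    using assms by auto
  then show ?thesis by (simp add: norm_eq_suminf suminf_add summable_coord del: coord_restr)
qed

lemma norm_restr_mono:
  assumes "A \<subseteq> B"
  shows "norm (restr A x) \<le> norm (restr B x)"
  using norm_restr_Un[of A "B - A" x] assms by (simp add: Un_absorb1)

lemma restr_UNIV [simp]: "restr UNIV x = x"
  by (rule ell1_eqI) auto

lemma norm_restr_le: "norm (restr A x) \<le> norm x"
  using norm_restr_mono[of A UNIV x] by simp

lemma norm_restr_Compl: "norm x = norm (restr A x) + norm (restr (- A) x)"
  using norm_restr_Un[of A "- A" x] by simp

lemma norm_restr_Un_le: "norm (restr (A \<union> B) x) \<le> norm (restr A x) + norm (restr B x)"
  using norm_restr_Un[of A "B - A" x] norm_restr_mono[of "B - A" B x] by simp

lemma restr_split: "x = restr A x + restr (- A) x"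
  by (rule ell1_eqI) auto

lemma norm_restr_finite:
  assumes "finite F" shows "norm (restr F x) = (\<Sum>i\<in>F. norm (coord x i))"
proof -
  have "(\<Sum>i. norm (coord (restr F x) i)) = (\<Sum>i\<in>F. norm (coord (restr F x) i))"
    by (rule suminf_finite) (auto simp: assms)
  then show ?thesis by (simp add: norm_eq_suminf)
qed

lemma tail_tendsto_0: "(\<lambda>n. norm (restr {n..} x)) \<longlonglongrightarrow> 0"
proof -
  have "(\<lambda>n. norm x - (\<Sum>i<n. norm (coord x i))) \<longlonglongrightarrow> norm x - norm x"
    by (intro tendsto_intros) (metis norm_eq_suminf summable_LIMSEQ summable_coord)
  moreover have "norm x - (\<Sum>i<n. norm (coord x i)) = norm (restr {n..} x)" for n
  proof -
    have "- {..<n} = {n..}" by auto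
    then show ?thesis using norm_restr_Compl[of x "{..<n}"]
      by (simp add: norm_restr_finite)
  qed
  ultimately show ?thesis by simp
qed

lemma coord_tendsto_0: "coord x \<longlonglongrightarrow> 0"
  using summable_LIMSEQ_zero[OF summable_coord[of x]] by (simp add: tendsto_norm_zero_iff)

lemma bounded_clinearI:
  assumes "\<And>x y. T (x + y) = T x + T y" "\<And>c x. T (c *\<^sub>C x) = c *\<^sub>C T x"
    and "\<And>x. norm (T x) \<le> C * norm x"
  shows "bounded_clinear T"
  unfolding bounded_clinear_def
proof (intro conjI allI)
  show "bounded_linear T"
    by (rule bounded_linear_intro[of _ C])
       (use assms in \<open>auto simp: mult.commute scaleC_of_real[symmetric]\<close>)
qed (fact assms(2))

lemma bounded_clinear_imp_linear: "bounded_clinear T \<Longrightarrow> bounded_linear T"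
  and bounded_clinear_scaleC: "bounded_clinear T \<Longrightarrow> T (c *\<^sub>C x) = c *\<^sub>C T x"
  by (auto simp: bounded_clinear_def)

lemma bounded_clinear_add_diff:
  assumes "bounded_clinear T"
  shows "T (x + y) = T x + T y" "T (x - y) = T x - T y" "T (- x) = - T x" "T 0 = 0"
  using bounded_linear.linear[OF bounded_clinear_imp_linear[OF assms]]
  by (simp_all add: linear_add linear_diff linear_neg linear_0)

lemmas clin = bounded_clinear_scaleC bounded_clinear_add_diff

lemma bounded_clinear_onorm: "bounded_clinear T \<Longrightarrow> norm (T x) \<le> onorm T * norm x"
  by (rule onorm[OF bounded_clinear_imp_linear])

lemma bounded_clinear_id: "bounded_clinear (\<lambda>x. x)"
  by (rule bounded_clinearI[of _ 1]) auto

lemma bounded_clinear_scale: "bounded_clinear (\<lambda>x. c *\<^sub>C x)"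
  by (rule bounded_clinearI[of _ "norm c"]) (auto simp: norm_scaleC mult.commute)

lemma bounded_clinear_zero: "bounded_clinear (\<lambda>x. 0)"
  by (rule bounded_clinearI[of _ 0]) auto

lemma bounded_clinear_restr: "bounded_clinear (restr A)"
  by (rule bounded_clinearI[of _ 1]) (auto intro: ell1_eqI simp: norm_restr_le)

lemma bounded_clinear_comp:
  "bounded_clinear S \<Longrightarrow> bounded_clinear T \<Longrightarrow> bounded_clinear (\<lambda>x. S (T x))"
  by (auto simp: bounded_clinear_def intro: bounded_linear_compose)

lemma bounded_clinear_add:
  "bounded_clinear S \<Longrightarrow> bounded_clinear T \<Longrightarrow> bounded_clinear (\<lambda>x. S x + T x)"
  by (auto simp: bounded_clinear_def intro: bounded_linear_add)

lemma bounded_clinear_diff: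
  "bounded_clinear S \<Longrightarrow> bounded_clinear T \<Longrightarrow> bounded_clinear (\<lambda>x. S x - T x)"
  by (auto simp: bounded_clinear_def intro: bounded_linear_sub)

lemma bounded_clinear_minus: "bounded_clinear T \<Longrightarrow> bounded_clinear (\<lambda>x. - T x)"
  by (auto simp: bounded_clinear_def intro: bounded_linear_minus)

lemma bounded_clinear_scaled: "bounded_clinear T \<Longrightarrow> bounded_clinear (\<lambda>x. c *\<^sub>C T x)"
  by (rule bounded_clinear_comp[OF bounded_clinear_scale])

lemma bounded_clinear_funpow: "bounded_clinear T \<Longrightarrow> bounded_clinear (T ^^ n)"
  by (induction n) (auto simp: bounded_clinear_id comp_def id_def intro: bounded_clinear_comp)

text \<open>Composition enters only with a fixed left factor: the general rule would unify with every goal,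
  taking the identity as one of the factors.\<close>

lemmas bclin_intros = bounded_clinear_id bounded_clinear_zero
  bounded_clinear_comp[OF bounded_clinear_restr] bounded_clinear_add bounded_clinear_diff
  bounded_clinear_minus bounded_clinear_scaled

lemma basis_expansion: "(\<lambda>j. coord x j *\<^sub>C basis j) sums x"
proof -
  have part: "(\<Sum>j<n. coord x j *\<^sub>C basis j) = x - restr {n..} x" for n
  proof (rule ell1_eqI)
    fix i
    have "coord (\<Sum>j<n. coord x j *\<^sub>C basis j) i = (\<Sum>j<n. coord (coord x j *\<^sub>C basis j) i)"
      by (induction n) auto
    also have "\<dots> = (if i < n then coord x i else 0)"
      by (simp add: if_distrib[of "\<lambda>t. _ * t"] sum.delta cong: if_cong)
    finally show "coord (\<Sum>j<n. coord x j *\<^sub>C basis j) i = coord (x - restr {n..} x) i" by simp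
  qed
  have "(\<lambda>n. restr {n..} x) \<longlonglongrightarrow> 0"
    using tail_tendsto_0 by (rule tendsto_norm_zero_cancel)
  then have "(\<lambda>n. x - restr {n..} x) \<longlonglongrightarrow> x - 0" by (intro tendsto_intros)
  then show ?thesis unfolding sums_def part by simp
qed

lemma bounded_clinear_eqI:
  assumes S: "bounded_clinear S" and T: "bounded_clinear T" and eq: "\<And>j. S (basis j) = T (basis j)"
  shows "S x = T x"
proof -
  have "(\<lambda>j. S (coord x j *\<^sub>C basis j)) sums S x" "(\<lambda>j. T (coord x j *\<^sub>C basis j)) sums T x"
    using S T by (auto intro: bounded_linear.sums bounded_clinear_imp_linear basis_expansion)
  then show ?thesis
    by (simp add: clin S T eq sums_unique2)
qed

text \<open>The unit ball of \<open>\<ell>\<^sub>1\<close> is the closed convex hull of the unit vectors and their rotations, so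
  the norm of an operator is the supremum of the norms of its columns.\<close>

lemma norm_le_columns:
  assumes T: "bounded_clinear T" and C: "\<And>j. norm (T (basis j)) \<le> C"
  shows "norm (T x) \<le> C * norm x"
proof -
  have s: "(\<lambda>j. T (coord x j *\<^sub>C basis j)) sums T x"
    using T by (auto intro: bounded_linear.sums bounded_clinear_imp_linear basis_expansion)
  have le: "norm (T (coord x j *\<^sub>C basis j)) \<le> C * norm (coord x j)" for j
    using mult_left_mono[OF C[of j], of "norm (coord x j)"]
    by (simp add: clin[OF T] norm_scaleC mult.commute)
  have sC: "summable (\<lambda>j. C * norm (coord x j))" by (intro summable_mult summable_coord)
  have sT: "summable (\<lambda>j. norm (T (coord x j *\<^sub>C basis j)))"
    by (rule summable_comparison_test'[OF sC]) (use le in auto)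
  have "norm (T x) \<le> (\<Sum>j. norm (T (coord x j *\<^sub>C basis j)))"
    using summable_norm[OF sT] s by (simp add: sums_iff)
  also have "\<dots> \<le> (\<Sum>j. C * norm (coord x j))" by (rule suminf_le[OF le sT sC])
  also have "\<dots> = C * norm x" by (simp add: suminf_mult summable_coord norm_eq_suminf)
  finally show ?thesis .
qed

text \<open>The operator whose matrix has the columns \<open>f j\<close>; it is bounded as soon as these are.\<close>

definition cols :: "(nat \<Rightarrow> ell1) \<Rightarrow> ell1 \<Rightarrow> ell1" where
  "cols f x = (\<Sum>j. coord x j *\<^sub>C f j)"

context
  fixes f :: "nat \<Rightarrow> ell1" and C :: real
  assumes f: "\<And>j. norm (f j) \<le> C"
begin

lemma summable_norm_cols: "summable (\<lambda>j. norm (coord x j *\<^sub>C f j))"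
  by (rule summable_comparison_test'[OF summable_mult[OF summable_coord, of C x]])
     (use f in \<open>auto simp: norm_scaleC mult.commute intro!: mult_right_mono\<close>)

lemma cols_sums: "(\<lambda>j. coord x j *\<^sub>C f j) sums cols f x"
  unfolding cols_def by (rule summable_sums[OF summable_norm_cancel[OF summable_norm_cols]])

lemma coord_cols: "coord (cols f x) i = (\<Sum>j. coord x j * coord (f j) i)"
  using bounded_linear.sums[OF bounded_linear_coord cols_sums] by (auto simp: sums_iff)

lemma bounded_clinear_cols: "bounded_clinear (cols f)"
proof (rule bounded_clinearI)
  show "cols f (x + y) = cols f x + cols f y" for x y
    using sums_add[OF cols_sums cols_sums, of x y]
    by (intro sums_unique2[OF cols_sums]) (simp add: scaleC_add_left)
  show "cols f (c *\<^sub>C x) = c *\<^sub>C cols f x" for c x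
    using bounded_linear.sums[OF bounded_linear_scaleC cols_sums, of c x]
    by (intro sums_unique2[OF cols_sums]) simp
  show "norm (cols f x) \<le> C * norm x" for x
  proof -
    have "norm (cols f x) \<le> (\<Sum>j. norm (coord x j *\<^sub>C f j))"
      unfolding cols_def by (rule summable_norm[OF summable_norm_cols])
    also have "\<dots> \<le> (\<Sum>j. C * norm (coord x j))"
      by (rule suminf_le[OF _ summable_norm_cols summable_mult[OF summable_coord]])
         (use f in \<open>auto simp: norm_scaleC mult.commute intro!: mult_right_mono\<close>)
    finally show ?thesis by (simp add: suminf_mult summable_coord norm_eq_suminf)
  qed
qed

lemma cols_basis: "cols f (basis j) = f j"
proof -
  have "(\<Sum>k. coord (basis j) k *\<^sub>C f k) = (\<Sum>k\<in>{j}. coord (basis j) k *\<^sub>C f k)"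
    by (rule suminf_finite) auto
  then show ?thesis by (simp add: cols_def)
qed

end

section \<open>Compactness and the essential norm\<close>

definition tail_norm :: "(ell1 \<Rightarrow> ell1) \<Rightarrow> nat \<Rightarrow> real" where
  "tail_norm T n = onorm (\<lambda>x. restr {n..} (T x))"

text \<open>This is the distance to the compact operators. It is written with row tails because these are
  what the matrix arguments below see.\<close>

definition ess_norm :: "(ell1 \<Rightarrow> ell1) \<Rightarrow> real" where
  "ess_norm T = (INF n. tail_norm T n)"

lemma tail_norm:
  "bounded_clinear T \<Longrightarrow> norm (restr {n..} (T x)) \<le> tail_norm T n * norm x"
  unfolding tail_norm_def
  by (rule bounded_clinear_onorm[OF bounded_clinear_comp[OF bounded_clinear_restr]])

lemma tail_norm_le:
  "0 \<le> C \<Longrightarrow> (\<And>x. norm (restr {n..} (T x)) \<le> C * norm x) \<Longrightarrow> tail_norm T n \<le> C"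
  unfolding tail_norm_def by (rule onorm_bound)

lemma tail_norm_le_columns:
  assumes "bounded_clinear T" "\<And>j. norm (restr {n..} (T (basis j))) \<le> C"
  shows "tail_norm T n \<le> C"
proof (rule tail_norm_le)
  show "0 \<le> C" using assms(2)[of 0] norm_ge_zero order_trans by blast
  show "norm (restr {n..} (T x)) \<le> C * norm x" for x
    using norm_le_columns[of "\<lambda>x. restr {n..} (T x)" C x] assms by (simp add: bounded_clinear_comp[OF bounded_clinear_restr])
qed

lemma tail_norm_nonneg: "bounded_clinear T \<Longrightarrow> 0 \<le> tail_norm T n"
  unfolding tail_norm_def by (intro onorm_pos_le bounded_clinear_imp_linear bounded_clinear_comp[OF bounded_clinear_restr])

lemma tail_norm_decseq:
  assumes T: "bounded_clinear T" shows "decseq (tail_norm T)"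
proof (rule decseq_SucI, rule tail_norm_le[OF tail_norm_nonneg[OF T]])
  fix n x
  have "norm (restr {Suc n..} (T x)) \<le> norm (restr {n..} (T x))" by (rule norm_restr_mono) auto
  also have "\<dots> \<le> tail_norm T n * norm x" by (rule tail_norm[OF T])
  finally show "norm (restr {Suc n..} (T x)) \<le> tail_norm T n * norm x" .
qed

lemma tail_norm_tendsto: "bounded_clinear T \<Longrightarrow> tail_norm T \<longlonglongrightarrow> ess_norm T"
  unfolding ess_norm_def
  by (intro LIMSEQ_decseq_INF tail_norm_decseq bdd_belowI2[of _ 0]) (auto simp: tail_norm_nonneg)

lemma ess_norm_nonneg: "bounded_clinear T \<Longrightarrow> 0 \<le> ess_norm T"
  by (rule LIMSEQ_le_const[OF tail_norm_tendsto]) (auto simp: tail_norm_nonneg)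

lemma ess_norm_add_le:
  assumes S: "bounded_clinear S" and T: "bounded_clinear T"
  shows "ess_norm (\<lambda>x. S x + T x) \<le> ess_norm S + ess_norm T"
proof (rule LIMSEQ_le)
  show "tail_norm (\<lambda>x. S x + T x) \<longlonglongrightarrow> ess_norm (\<lambda>x. S x + T x)"
    by (intro tail_norm_tendsto bclin_intros S[THEN bounded_clinear_comp] T[THEN bounded_clinear_comp])
  show "(\<lambda>n. tail_norm S n + tail_norm T n) \<longlonglongrightarrow> ess_norm S + ess_norm T"
    by (intro tendsto_intros tail_norm_tendsto S T)
  have "tail_norm (\<lambda>x. S x + T x) n \<le> tail_norm S n + tail_norm T n" for n
  proof (rule tail_norm_le)
    show "norm (restr {n..} (S x + T x)) \<le> (tail_norm S n + tail_norm T n) * norm x" for x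
      using tail_norm[OF S, of n x] tail_norm[OF T, of n x]
      by (simp add: clin[OF bounded_clinear_restr] algebra_simps norm_triangle_le)
  qed (simp add: tail_norm_nonneg S T)
  then show "\<exists>N. \<forall>n\<ge>N. tail_norm (\<lambda>x. S x + T x) n \<le> tail_norm S n + tail_norm T n" by blast
qed

lemma ess_norm_scale:
  assumes T: "bounded_clinear T"
  shows "ess_norm (\<lambda>x. c *\<^sub>C T x) = norm c * ess_norm T"
proof -
  have le: "ess_norm (\<lambda>x. c *\<^sub>C S x) \<le> norm c * ess_norm S" if S: "bounded_clinear S" for S c
  proof (rule LIMSEQ_le)
    show "tail_norm (\<lambda>x. c *\<^sub>C S x) \<longlonglongrightarrow> ess_norm (\<lambda>x. c *\<^sub>C S x)"
      by (intro tail_norm_tendsto bclin_intros S[THEN bounded_clinear_comp])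
    show "(\<lambda>n. norm c * tail_norm S n) \<longlonglongrightarrow> norm c * ess_norm S"
      by (intro tendsto_intros tail_norm_tendsto S)
    have "tail_norm (\<lambda>x. c *\<^sub>C S x) n \<le> norm c * tail_norm S n" for n
    proof (rule tail_norm_le)
      show "norm (restr {n..} (c *\<^sub>C S x)) \<le> norm c * tail_norm S n * norm x" for x
        using mult_left_mono[OF tail_norm[OF S, of n x], of "norm c"]
        by (simp add: clin[OF bounded_clinear_restr] norm_scaleC mult.assoc)
    qed (simp add: tail_norm_nonneg S)
    then show "\<exists>N. \<forall>n\<ge>N. tail_norm (\<lambda>x. c *\<^sub>C S x) n \<le> norm c * tail_norm S n" by blast
  qed
  show ?thesis
  proof (cases "c = 0")
    case True
    then show ?thesis
      using le[OF T, of 0] ess_norm_nonneg[OF bounded_clinear_zero] by simp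
  next
    case False
    have "ess_norm (\<lambda>x. inverse c *\<^sub>C c *\<^sub>C T x) \<le> norm (inverse c) * ess_norm (\<lambda>x. c *\<^sub>C T x)"
      by (intro le bclin_intros T[THEN bounded_clinear_comp])
    moreover have "inverse c *\<^sub>C c *\<^sub>C y = y" for y
      using False by simp
    ultimately have "norm c * ess_norm T \<le> ess_norm (\<lambda>x. c *\<^sub>C T x)"
      using False by (simp only: norm_inverse) (simp add: field_simps)
    then show ?thesis using le[OF T, of c] by simp
  qed
qed

lemma ess_norm_comp_right:
  assumes S: "bounded_clinear S" and T: "bounded_clinear T"
  shows "ess_norm (\<lambda>x. S (T x)) \<le> ess_norm S * onorm T"
proof (rule LIMSEQ_le)
  show "tail_norm (\<lambda>x. S (T x)) \<longlonglongrightarrow> ess_norm (\<lambda>x. S (T x))"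
    by (intro tail_norm_tendsto bclin_intros S[THEN bounded_clinear_comp] T[THEN bounded_clinear_comp])
  show "(\<lambda>n. tail_norm S n * onorm T) \<longlonglongrightarrow> ess_norm S * onorm T"
    by (intro tendsto_intros tail_norm_tendsto S)
  have "tail_norm (\<lambda>x. S (T x)) n \<le> tail_norm S n * onorm T" for n
  proof (rule tail_norm_le)
    show "0 \<le> tail_norm S n * onorm T"
      by (simp add: tail_norm_nonneg S onorm_pos_le bounded_clinear_imp_linear T)
    show "norm (restr {n..} (S (T x))) \<le> tail_norm S n * onorm T * norm x" for x
    proof -
      have "norm (restr {n..} (S (T x))) \<le> tail_norm S n * norm (T x)" by (rule tail_norm[OF S])
      also have "\<dots> \<le> tail_norm S n * (onorm T * norm x)"
        by (intro mult_left_mono bounded_clinear_onorm T tail_norm_nonneg S)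
      finally show ?thesis by (simp add: mult.assoc)
    qed
  qed
  then show "\<exists>N. \<forall>n\<ge>N. tail_norm (\<lambda>x. S (T x)) n \<le> tail_norm S n * onorm T" by blast
qed

text \<open>
  Cutting \<open>T\<close> at height \<open>n\<close> splits \<open>S T\<close> into \<open>S\<close> applied to a tail, which is controlled by the tail
  of \<open>T\<close>, and \<open>S\<close> applied to a vector supported on finitely many coordinates, whose tails vanish
  uniformly because only finitely many columns of \<open>S\<close> are involved.
\<close>

lemma ess_norm_comp_left:
  assumes S: "bounded_clinear S" and T: "bounded_clinear T"
  shows "ess_norm (\<lambda>x. S (T x)) \<le> onorm S * ess_norm T"
proof -
  have b: "ess_norm (\<lambda>x. S (T x)) \<le> onorm S * tail_norm T n" for n
  proof -
    define g where "g m = (\<Sum>j<n. norm (restr {m..} (S (basis j))))" for m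
    have head: "norm (restr {m..} (S (restr {..<n} y))) \<le> g m * norm y" for m y
    proof (rule norm_le_columns)
      show "bounded_clinear (\<lambda>y. restr {m..} (S (restr {..<n} y)))" by (intro bclin_intros S[THEN bounded_clinear_comp])
      show "norm (restr {m..} (S (restr {..<n} (basis j)))) \<le> g m" for j
        unfolding g_def
        by (cases "j < n") (auto simp: clin[OF S] clin[OF bounded_clinear_restr] sum_nonneg
              intro: member_le_sum[of j "{..<n}" "\<lambda>j. norm (restr {m..} (S (basis j)))"])
    qed
    have g0: "g m \<ge> 0" for m by (simp add: g_def sum_nonneg)
    have nn: "0 \<le> onorm S" "0 \<le> onorm T" "0 \<le> tail_norm T n"
      using S T by (auto intro: onorm_pos_le bounded_clinear_imp_linear tail_norm_nonneg)
    have "tail_norm (\<lambda>x. S (T x)) m \<le> onorm S * tail_norm T n + g m * onorm T" for m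
    proof (rule tail_norm_le)
      show "0 \<le> onorm S * tail_norm T n + g m * onorm T" by (simp add: nn g0)
      fix x
      have "S (T x) = S (restr {n..} (T x)) + S (restr {..<n} (T x))"
        using restr_split[of "T x" "{n..}"]
        by (metis (no_types) clin(2)[OF S] Compl_atLeast)
      then have "norm (restr {m..} (S (T x))) \<le>
            norm (restr {m..} (S (restr {n..} (T x)))) + norm (restr {m..} (S (restr {..<n} (T x))))"
        by (simp add: clin[OF bounded_clinear_restr] norm_triangle_ineq)
      also have "\<dots> \<le> onorm S * (tail_norm T n * norm x) + g m * (onorm T * norm x)"
      proof (rule add_mono)
        have "norm (restr {m..} (S (restr {n..} (T x)))) \<le> norm (S (restr {n..} (T x)))"
          by (rule norm_restr_le)
        also have "\<dots> \<le> onorm S * norm (restr {n..} (T x))" by (rule bounded_clinear_onorm[OF S])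
        also have "\<dots> \<le> onorm S * (tail_norm T n * norm x)"
          by (intro mult_left_mono tail_norm T nn)
        finally show "norm (restr {m..} (S (restr {n..} (T x)))) \<le> onorm S * (tail_norm T n * norm x)" .
        show "norm (restr {m..} (S (restr {..<n} (T x)))) \<le> g m * (onorm T * norm x)"
          using head[of m "T x"] mult_left_mono[OF bounded_clinear_onorm[OF T, of x] g0[of m]] by simp
      qed
      finally show "norm (restr {m..} (S (T x))) \<le> (onorm S * tail_norm T n + g m * onorm T) * norm x"
        by (simp add: algebra_simps)
    qed
    moreover have "g \<longlonglongrightarrow> (\<Sum>j<n. 0)"
      unfolding g_def by (intro tendsto_sum tail_tendsto_0)
    then have "(\<lambda>m. onorm S * tail_norm T n + g m * onorm T)
        \<longlonglongrightarrow> onorm S * tail_norm T n + 0 * onorm T"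
      by (intro tendsto_intros) simp
    ultimately show ?thesis
      using tail_norm_tendsto[of "\<lambda>x. S (T x)"] S T
      by (intro LIMSEQ_le[of "tail_norm (\<lambda>x. S (T x))" _
            "\<lambda>m. onorm S * tail_norm T n + g m * onorm T"]) (auto intro: bounded_clinear_comp)
  qed
  show ?thesis
    by (rule LIMSEQ_le_const[of "\<lambda>n. onorm S * tail_norm T n"])
       (use b in \<open>auto intro!: tendsto_intros tail_norm_tendsto T\<close>)
qed

lemma ess_norm_id: "ess_norm (\<lambda>x. x) \<ge> 1"
proof (rule LIMSEQ_le_const[OF tail_norm_tendsto[OF bounded_clinear_id]], intro exI allI impI)
  show "1 \<le> tail_norm (\<lambda>x. x) n" for n
    using tail_norm[OF bounded_clinear_id, of n "basis n"] by simp
qed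

text \<open>Uniform tails reduce compactness to coordinatewise convergence, which a diagonal argument
  supplies for any bounded sequence.\<close>

lemma compact_tails:
  assumes T: "bounded_clinear T" and 0: "ess_norm T = 0"
  shows "compact {y. norm y \<le> onorm T \<and> (\<forall>n. norm (restr {n..} y) \<le> tail_norm T n)}"
    (is "compact ?A")
  unfolding compact_def
proof (intro allI impI)
  fix s :: "nat \<Rightarrow> ell1" assume s: "\<forall>n. s n \<in> ?A"
  obtain k where k: "strict_mono (k :: nat \<Rightarrow> nat)"
    and lim: "\<And>i. i \<in> UNIV \<Longrightarrow> \<exists>l. (\<lambda>n. coord (s (k n)) i) \<longlonglongrightarrow> l"
    using function_convergent_subsequence[of UNIV "\<lambda>n. coord (s n)" "onorm T"]
      s norm_coord_le order_trans by (smt (verit, best) countableI_type mem_Collect_eq)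
  have "Cauchy (\<lambda>n. s (k n))"
    unfolding Cauchy_iff
  proof (intro allI impI)
    fix e :: real assume e: "0 < e"
    obtain n where n: "tail_norm T n < e / 4"
      using order_tendstoD(2)[OF tail_norm_tendsto[OF T], of "e / 4"] 0 e
      by (auto simp: eventually_sequentially)
    \<comment> \<open>Beyond \<open>n\<close> the tails are uniformly small; below \<open>n\<close> coordinatewise convergence suffices.\<close>
    have "Cauchy (\<lambda>m. coord (s (k m)) i)" for i
      using lim[of i] LIMSEQ_imp_Cauchy by blast
    then have "\<exists>M. \<forall>p\<ge>M. \<forall>q\<ge>M. norm (coord (s (k p)) i - coord (s (k q)) i) < e / (4 * (n + 1))" for i
      using e unfolding Cauchy_iff by simp
    then obtain M where M: "\<And>i p q. p \<ge> M i \<Longrightarrow> q \<ge> M i \<Longrightarrow>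
        norm (coord (s (k p)) i - coord (s (k q)) i) < e / (4 * (n + 1))" by metis
    show "\<exists>M. \<forall>p\<ge>M. \<forall>q\<ge>M. norm (s (k p) - s (k q)) < e"
    proof (intro exI[of _ "\<Sum>i<n. M i"] allI impI)
      fix p q assume pq: "(\<Sum>i<n. M i) \<le> p" "(\<Sum>i<n. M i) \<le> q"
      have Mi: "M i \<le> (\<Sum>i<n. M i)" if "i < n" for i
        using that by (intro member_le_sum) auto
      have "norm (restr {..<n} (s (k p) - s (k q))) \<le> (\<Sum>i<n. e / (4 * (n + 1)))"
        unfolding norm_restr_finite[OF finite_lessThan] using M pq Mi
        by (intro sum_mono) (simp, meson le_trans less_imp_le)
      also have "\<dots> \<le> e / 4" using e by (simp add: field_simps)
      finally have h: "norm (restr {..<n} (s (k p) - s (k q))) \<le> e / 4" .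
      have "norm (restr {n..} (s (k p) - s (k q)))
          \<le> norm (restr {n..} (s (k p))) + norm (restr {n..} (s (k q)))"
        by (simp add: clin[OF bounded_clinear_restr] norm_triangle_ineq4)
      also have "\<dots> \<le> tail_norm T n + tail_norm T n" using s by (intro add_mono) auto
      finally have "norm (restr {n..} (s (k p) - s (k q))) < e / 2" using n by simp
      then show "norm (s (k p) - s (k q)) < e"
        using h norm_restr_Compl[of "s (k p) - s (k q)" "{n..}"] e by simp
    qed
  qed
  then obtain l where l: "(\<lambda>n. s (k n)) \<longlonglongrightarrow> l" using Cauchy_convergent convergent_def by blast
  have "norm l \<le> onorm T"
    by (rule LIMSEQ_le_const2[OF tendsto_norm[OF l]]) (use s in auto)
  moreover have "norm (restr {n..} l) \<le> tail_norm T n" for n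
    by (rule LIMSEQ_le_const2[OF tendsto_norm[OF bounded_linear.tendsto[OF
          bounded_clinear_imp_linear[OF bounded_clinear_restr] l]]]) (use s in auto)
  ultimately show "\<exists>l\<in>?A. \<exists>r. strict_mono r \<and> (s \<circ> r) \<longlonglongrightarrow> l"
    using k l by (intro bexI[of _ l] exI[of _ k]) (auto simp: comp_def)
qed

text \<open>One direction confines the image of the ball to the compact set above. For the other, a finite
  net of the image has uniformly small tails, hence so has the whole image.\<close>

lemma compact_operator_iff_ess_norm:
  assumes T: "bounded_clinear T"
  shows "compact_operator T \<longleftrightarrow> ess_norm T = 0"
proof
  assume "ess_norm T = 0"
  let ?A = "{y. norm y \<le> onorm T \<and> (\<forall>n. norm (restr {n..} y) \<le> tail_norm T n)}"
  have A: "compact ?A" by (rule compact_tails) fact+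
  have "T ` cball 0 1 \<subseteq> ?A"
  proof clarify
    fix x :: ell1 assume x: "x \<in> cball 0 1"
    have "norm (T x) \<le> onorm T * norm x" "norm (restr {n..} (T x)) \<le> tail_norm T n * norm x" for n
      using bounded_clinear_onorm[OF T] tail_norm[OF T] by auto
    moreover have "onorm T * norm x \<le> onorm T" "tail_norm T n * norm x \<le> tail_norm T n" for n
      using x T by (auto intro!: mult_left_le tail_norm_nonneg onorm_pos_le bounded_clinear_imp_linear)
    ultimately show "norm (T x) \<le> onorm T \<and> (\<forall>n. norm (restr {n..} (T x)) \<le> tail_norm T n)"
      by (meson order_trans)
  qed
  then have "closure (T ` cball 0 1) \<subseteq> ?A"
    using A compact_imp_closed closure_minimal by blast
  then have "compact (closure (T ` cball 0 1))"
    using compact_Int_closed[OF A closed_closure, of "T ` cball 0 1"] by (simp only: Int_absorb1)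
  then show "compact_operator T" using T by (simp add: compact_operator_def)
next
  assume "compact_operator T"
  then have "compact (closure (T ` cball 0 1))" by (simp add: compact_operator_def)
  then have tb: "\<exists>F. finite F \<and> closure (T ` cball 0 1) \<subseteq> (\<Union>y\<in>F. ball y e)" if "e > 0" for e
    using that by (simp add: compact_eq_totally_bounded)
  have "ess_norm T \<le> e" if "e > 0" for e
  proof -
    obtain F where F: "finite F" "closure (T ` cball 0 1) \<subseteq> (\<Union>y\<in>F. ball y (e / 2))"
      using tb[of "e / 2"] \<open>e > 0\<close> by auto
    have "\<forall>\<^sub>F n in sequentially. norm (restr {n..} y) < e / 2" for y
      using \<open>e > 0\<close> by (intro order_tendstoD(2)[OF tail_tendsto_0]) simp
    then have "\<forall>\<^sub>F n in sequentially. \<forall>y\<in>F. norm (restr {n..} y) < e / 2"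
      using F(1) by (simp add: eventually_ball_finite)
    then obtain n where n: "\<forall>y\<in>F. norm (restr {n..} y) < e / 2"
      by (auto simp: eventually_sequentially)
    have "norm (restr {n..} (T (basis j))) \<le> e" for j
    proof -
      have "T (basis j) \<in> closure (T ` cball 0 1)"
        by (rule subsetD[OF closure_subset]) (simp add: norm_basis)
      then obtain y where y: "y \<in> F" "norm (T (basis j) - y) < e / 2"
        using F(2) by (auto simp: dist_norm norm_minus_commute)
      have "norm (restr {n..} (T (basis j)))
          \<le> norm (restr {n..} (T (basis j) - y)) + norm (restr {n..} y)"
        using norm_triangle_ineq[of "restr {n..} (T (basis j) - y)" "restr {n..} y"]
        by (simp add: clin[OF bounded_clinear_restr])
      also have "\<dots> \<le> e / 2 + e / 2"
        using y n norm_restr_le[of "{n..}" "T (basis j) - y"] by (intro add_mono) auto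
      finally show ?thesis by simp
    qed
    then have "tail_norm T n \<le> e" by (rule tail_norm_le_columns[OF T])
    moreover have "ess_norm T \<le> tail_norm T n"
      using decseq_ge[OF tail_norm_decseq[OF T] tail_norm_tendsto[OF T]] .
    ultimately show ?thesis by simp
  qed
  then show "ess_norm T = 0"
    using ess_norm_nonneg[OF T] field_le_epsilon[of "ess_norm T" 0] by fastforce
qed

section \<open>Commutators are not scalar plus compact\<close>

text \<open>Wielandt's argument: the ratio of the seminorms of \<open>B ^^ Suc n\<close> and \<open>B ^^ n\<close> is at most the norm
  of \<open>B\<close>, but the commutator relation would make it grow linearly in \<open>n\<close>.\<close>

lemma commutator_ess_norm_pos:
  assumes A: "bounded_clinear A" and B: "bounded_clinear B" and c: "c \<noteq> 0"
  shows "ess_norm (\<lambda>x. A (B x) - B (A x) - c *\<^sub>C x) \<noteq> 0"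
proof
  define K where "K x = A (B x) - B (A x) - c *\<^sub>C x" for x
  assume "ess_norm (\<lambda>x. A (B x) - B (A x) - c *\<^sub>C x) = 0"
  then have K0: "ess_norm K = 0" by (simp add: K_def[abs_def])
  have K: "bounded_clinear K" unfolding K_def by (intro bclin_intros A[THEN bounded_clinear_comp] B[THEN bounded_clinear_comp])
  note Bn = bounded_clinear_funpow[OF B]
  have nA: "onorm A \<ge> 0" and nB: "onorm B \<ge> 0"
    using A B by (auto intro: onorm_pos_le bounded_clinear_imp_linear)
  define D where "D n x = A ((B ^^ Suc n) x) - (B ^^ Suc n) (A x) - (of_nat (Suc n) * c) *\<^sub>C (B ^^ n) x" for n x
  have D: "bounded_clinear (D n)" for n unfolding D_def by (intro bclin_intros A[THEN bounded_clinear_comp] Bn[THEN bounded_clinear_comp])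
  \<comment> \<open>The commutator with \<open>A\<close> is a derivation that sends \<open>B\<close> to a scalar modulo compact operators.\<close>
  have D0: "ess_norm (D n) = 0" for n
  proof (induction n)
    case 0
    have "D 0 = K" by (auto simp: D_def K_def fun_eq_iff)
    then show ?case by (simp add: K0)
  next
    case (Suc n)
    have "(of_nat (Suc (Suc n)) * c) *\<^sub>C y = (of_nat (Suc n) * c) *\<^sub>C y + c *\<^sub>C y" for y
      by (simp add: scaleC_add_left[symmetric] algebra_simps)
    then have "D (Suc n) x = D n (B x) + (B ^^ Suc n) (K x)" for x
      unfolding D_def K_def
      by (simp add: clin[OF Bn] clin[OF B] funpow_swap1 del: of_nat_Suc)
    then have "ess_norm (D (Suc n)) = ess_norm (\<lambda>x. D n (B x) + (B ^^ Suc n) (K x))" by metis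
    also have "\<dots> \<le> ess_norm (\<lambda>x. D n (B x)) + ess_norm (\<lambda>x. (B ^^ Suc n) (K x))"
      by (intro ess_norm_add_le bclin_intros D[THEN bounded_clinear_comp] B[THEN bounded_clinear_comp] Bn[THEN bounded_clinear_comp] K[THEN bounded_clinear_comp])
    also have "\<dots> \<le> ess_norm (D n) * onorm B + onorm (B ^^ Suc n) * ess_norm K"
      by (intro add_mono ess_norm_comp_left ess_norm_comp_right D B Bn K)
    also have "\<dots> = 0" by (simp add: Suc K0)
    finally show ?case using ess_norm_nonneg[OF D[of "Suc n"]] by simp
  qed
  have key: "real (Suc n) * norm c * ess_norm (B ^^ n) \<le> 2 * onorm A * ess_norm (B ^^ Suc n)" for n
  proof -
    have "real (Suc n) * norm c * ess_norm (B ^^ n)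
        = ess_norm (\<lambda>x. (of_nat (Suc n) * c) *\<^sub>C (B ^^ n) x)"
      by (simp add: ess_norm_scale[OF Bn] norm_mult del: of_nat_Suc)
    also have "\<dots> = ess_norm (\<lambda>x. (A ((B ^^ Suc n) x) + (- 1) *\<^sub>C (B ^^ Suc n) (A x)) + (- 1) *\<^sub>C D n x)"
      by (intro arg_cong[of _ _ ess_norm] ext) (simp add: D_def scaleC_minus_left)
    also have "\<dots> \<le> ess_norm (\<lambda>x. A ((B ^^ Suc n) x) + (- 1) *\<^sub>C (B ^^ Suc n) (A x))
        + ess_norm (\<lambda>x. (- 1) *\<^sub>C D n x)"
      by (intro ess_norm_add_le bclin_intros A[THEN bounded_clinear_comp] Bn[THEN bounded_clinear_comp] D[THEN bounded_clinear_comp])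
    also have "\<dots> \<le> (ess_norm (\<lambda>x. A ((B ^^ Suc n) x)) + ess_norm (\<lambda>x. (- 1) *\<^sub>C (B ^^ Suc n) (A x))) + 0"
      by (intro add_mono ess_norm_add_le bclin_intros A[THEN bounded_clinear_comp] Bn[THEN bounded_clinear_comp] D[THEN bounded_clinear_comp])
         (use ess_norm_scale[OF D, of "-1" n] D0 in simp)
    also have "\<dots> \<le> onorm A * ess_norm (B ^^ Suc n) + ess_norm (B ^^ Suc n) * onorm A"
      using ess_norm_comp_left[OF A Bn[of "Suc n"]] ess_norm_comp_right[OF Bn[of "Suc n"] A]
        ess_norm_scale[OF bounded_clinear_comp[OF Bn[of "Suc n"] A], of "-1"] by (simp add: mult.commute)
    finally show ?thesis by simp
  qed
  \<comment> \<open>A compact power forces the preceding power to be compact, and finally the identity.\<close>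
  have down: "ess_norm (B ^^ n) = 0" if "ess_norm (B ^^ Suc n) = 0" for n
    using key[of n] that c ess_norm_nonneg[OF Bn[of n]]
    by (simp add: mult_le_0_iff)
  have "ess_norm (B ^^ n) \<noteq> 0" for n
  proof (induction n)
    case 0
    then show ?case using ess_norm_id by (auto simp: id_def)
  qed (use down in blast)
  then have pos: "ess_norm (B ^^ n) > 0" for n
    using ess_norm_nonneg[OF Bn[of n]] by (simp add: order_less_le)
  have "real (Suc n) * norm c \<le> 2 * onorm A * onorm B" for n
  proof -
    have "ess_norm (B ^^ Suc n) \<le> onorm B * ess_norm (B ^^ n)"
      using ess_norm_comp_left[OF B Bn[of n]] by (simp add: comp_def)
    then have "real (Suc n) * norm c * ess_norm (B ^^ n) \<le> 2 * onorm A * (onorm B * ess_norm (B ^^ n))"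
      using key[of n] nA by (meson mult_left_mono order_trans zero_le_mult_iff zero_le_numeral)
    then show ?thesis using pos[of n] by (simp add: mult.assoc[symmetric])
  qed
  moreover obtain n :: nat where "2 * onorm A * onorm B / norm c < real n" using reals_Archimedean2 by blast
  then have "2 * onorm A * onorm B < real n * norm c" using c by (simp add: divide_less_eq)
  moreover have "real n * norm c \<le> real (Suc n) * norm c" by (intro mult_right_mono) auto
  ultimately show False by (meson less_le_trans not_le)
qed

section \<open>Extracting subsequences\<close>

text \<open>The next index of \<open>q\<close> exceeds the thresholds of all numbers up to the current one, so that it is
  compatible with every index chosen before.\<close>

lemma subsequence_pairwise:
  assumes "\<And>x. \<forall>\<^sub>F y in sequentially. R x y"
  obtains q where "strict_mono (q :: nat \<Rightarrow> nat)" "\<And>m n. m < n \<Longrightarrow> R (q m) (q n)"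
proof -
  obtain N where N: "\<And>x y. N x \<le> y \<Longrightarrow> R x y"
    using assms unfolding eventually_sequentially by metis
  define q where "q = rec_nat 0 (\<lambda>_ y. Suc y + (\<Sum>x\<le>y. N x))"
  have q_Suc: "q (Suc n) = Suc (q n) + (\<Sum>x\<le>q n. N x)" for n by (simp add: q_def)
  have mono: "strict_mono q" by (rule strict_mono_Suc_iff[THEN iffD2]) (simp add: q_Suc)
  have "R (q m) (q n)" if "m < n" for m n
  proof (rule N)
    have "q m \<le> q (n - 1)" using that strict_mono_less_eq[OF mono] by simp
    then have "N (q m) \<le> (\<Sum>x\<le>q (n - 1). N x)" by (intro member_le_sum) auto
    also have "\<dots> \<le> q n" using q_Suc[of "n - 1"] that by simp
    finally show "N (q m) \<le> q n" .
  qed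
  then show ?thesis using that mono by blast
qed

lemma subsequence_diagonal:
  assumes "\<And>k. \<forall>\<^sub>F y in sequentially. P k y"
  obtains q where "strict_mono (q :: nat \<Rightarrow> nat)" "\<And>k. P k (q k)"
proof -
  have "\<forall>\<^sub>F y in sequentially. \<forall>k\<in>{..x}. P k y" for x
    using assms by (intro eventually_ball_finite) auto
  then obtain q where q: "strict_mono (q :: nat \<Rightarrow> nat)" "\<And>m n. m < n \<Longrightarrow> \<forall>k\<in>{..q m}. P k (q n)"
    using subsequence_pairwise[of "\<lambda>x y. \<forall>k\<in>{..x}. P k y"] by auto
  have "P k (q (Suc k))" for k
    using q(2)[of k "Suc k"] strict_mono_imp_increasing[OF q(1), of k] by auto
  moreover have "strict_mono (\<lambda>k. q (Suc k))" using q(1) by (simp add: strict_mono_Suc_iff)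
  ultimately show ?thesis using that by blast
qed

section \<open>Commutators through a shift\<close>

lemma commutator_similar:
  assumes S: "bounded_clinear S" and S': "bounded_clinear S'"
    and SS': "\<And>x. S (S' x) = x" "\<And>x. S' (S x) = x"
    and T: "bounded_clinear T" and comm: "commutator (\<lambda>x. S' (T (S x)))"
  shows "commutator T"
proof -
  obtain A B where A: "bounded_clinear A" and B: "bounded_clinear B"
    and AB: "\<And>x. S' (T (S x)) = A (B x) - B (A x)"
    using comm unfolding commutator_def by metis
  have "T x = S (A (S' (S (B (S' x))))) - S (B (S' (S (A (S' x)))))" for x
  proof -
    have "T x = S (S' (T (S (S' x))))" by (simp add: SS')
    also have "\<dots> = S (A (B (S' x)) - B (A (S' x)))" by (simp only: AB)
    finally show ?thesis by (simp add: SS' clin[OF S])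
  qed
  moreover have "bounded_clinear (\<lambda>x. S (A (S' x)))" "bounded_clinear (\<lambda>x. S (B (S' x)))"
    using S S' A B by (auto intro: bounded_clinear_comp)
  ultimately show ?thesis
    unfolding commutator_def by (intro exI[of _ "\<lambda>x. S (A (S' x))"] exI[of _ "\<lambda>x. S (B (S' x))"]) auto
qed

text \<open>
  Arrange the unit vectors in a grid \<open>\<pi> m i\<close> such that the columns on level \<open>m\<close> have norm at most a
  constant times \<open>(1/2) ^ m\<close>; let \<open>R\<close> and \<open>L\<close> shift the levels up and down. The formal solution
  \<open>T + R T L + R\<^sup>2 T L\<^sup>2 + \<dots>\<close> of \<open>F - R F L = T\<close> has on level \<open>m\<close> a column that is the sum of \<open>m + 1\<close> terms,
  one from each of the levels \<open>0, \<dots>, m\<close>, so the geometric decay makes it a bounded operator. Then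
  \<open>T = L (R F) - (R F) L\<close>.
\<close>

lemma commutator_null_columns:
  assumes T: "bounded_clinear T" and a: "inj a"
    and null: "(\<lambda>k. norm (T (basis (a k)))) \<longlonglongrightarrow> 0"
  shows "commutator T"
proof -
  have "\<forall>\<^sub>F y in sequentially. norm (T (basis (a y))) \<le> (1/2) ^ k" for k
    using order_tendstoD(2)[OF null, of "(1/2) ^ k"] by (auto elim: eventually_mono)
  then obtain q where q: "strict_mono (q :: nat \<Rightarrow> nat)"
    and small: "\<And>k. norm (T (basis (a (q k)))) \<le> (1/2) ^ k"
    using subsequence_diagonal[of "\<lambda>k y. norm (T (basis (a y))) \<le> (1/2) ^ k"] by auto
  define b where "b k = a (q k)" for k
  have b: "inj b" by (auto simp: b_def inj_eq[OF a] strict_mono_eq[OF q] intro!: injI)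
  define U where "U = - (b ` {k. fst (prod_decode k) \<noteq> 0})"
  have "infinite U"
  proof
    assume "finite U"
    moreover have "(\<lambda>i. b (prod_encode (0, i))) ` UNIV \<subseteq> U"
      by (auto simp: U_def inj_eq[OF b])
    moreover have "inj (\<lambda>i. b (prod_encode (0, i)))"
      by (auto simp: inj_eq[OF b] intro!: injI)
    ultimately show False
      by (metis finite_subset finite_image_iff infinite_UNIV_nat)
  qed
  \<comment> \<open>Level \<open>0\<close> of the grid absorbs everything that is not placed on a higher level.\<close>
  define \<pi> where "\<pi> m i = (if m = 0 then enumerate U i else b (prod_encode (m, i)))" for m i
  have \<pi>_surj: "\<exists>m i. j = \<pi> m i" for j
  proof (cases "j \<in> U")
    case True
    then obtain i where "enumerate U i = j" using enumerate_Ex[OF \<open>infinite U\<close> True] by blast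
    then have "j = \<pi> 0 i" by (simp add: \<pi>_def)
    then show ?thesis by blast
  next
    case False
    then obtain k where k: "j = b k" "fst (prod_decode k) \<noteq> 0" by (auto simp: U_def)
    then have "j = \<pi> (fst (prod_decode k)) (snd (prod_decode k))" by (simp add: \<pi>_def)
    then show ?thesis by blast
  qed
  have \<pi>_inj: "m = m' \<and> i = i'" if eq: "\<pi> m i = \<pi> m' i'" for m i m' i'
  proof -
    have U: "enumerate U i \<in> U" for i by (rule enumerate_in_set[OF \<open>infinite U\<close>])
    have nU: "m \<noteq> 0 \<Longrightarrow> b (prod_encode (m, i)) \<notin> U" for m i by (auto simp: U_def)
    have "i = i'" if "enumerate U i = enumerate U i'"
      using that inj_enumerate[OF \<open>infinite U\<close>] by (simp add: inj_eq)
    moreover have "enumerate U k \<noteq> b (prod_encode (n, l))" if "n \<noteq> 0" for k n l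
      using U[of k] nU[OF that, of l] by metis
    ultimately show ?thesis
      using eq unfolding \<pi>_def by (auto simp: inj_eq[OF b] split: if_splits) metis+
  qed
  define coordinates where "coordinates j = (SOME (m, i). j = \<pi> m i)" for j
  have coordinates: "coordinates (\<pi> m i) = (m, i)" for m i
    unfolding coordinates_def by (rule some_equality) (auto dest: \<pi>_inj)
  define R where "R = cols (\<lambda>j. case coordinates j of (m, i) \<Rightarrow> basis (\<pi> (Suc m) i))"
  define L where "L = cols (\<lambda>j. case coordinates j of (0, i) \<Rightarrow> 0 | (Suc m, i) \<Rightarrow> basis (\<pi> m i))"
  have R: "bounded_clinear R" and R_\<pi>: "R (basis (\<pi> m i)) = basis (\<pi> (Suc m) i)" for m i
    unfolding R_def using bounded_clinear_cols[of _ 1] cols_basis[of _ 1]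
    by (simp_all add: coordinates split: prod.split)
  have L: "bounded_clinear L" and L_0: "L (basis (\<pi> 0 i)) = 0"
    and L_Suc: "L (basis (\<pi> (Suc m) i)) = basis (\<pi> m i)" for m i
    unfolding L_def using bounded_clinear_cols[of _ 1] cols_basis[of _ 1]
    by (simp_all add: coordinates split: prod.split nat.split)
  define C where "C = onorm T + 1"
  have T_\<pi>: "norm (T (basis (\<pi> m i))) \<le> C * (1/2) ^ m" for m i
  proof (cases m)
    case 0
    then show ?thesis using bounded_clinear_onorm[OF T, of "basis (\<pi> m i)"] by (simp add: C_def)
  next
    case (Suc m')
    have "norm (T (basis (\<pi> m i))) \<le> (1/2) ^ prod_encode (m, i)"
      using small[of "prod_encode (m, i)"] Suc by (simp add: \<pi>_def b_def)
    also have "\<dots> \<le> 1 * (1/2) ^ m"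
      by (simp add: power_decreasing le_prod_encode_1)
    also have "\<dots> \<le> C * (1/2) ^ m"
      using onorm_pos_le[OF bounded_clinear_imp_linear[OF T]]
      by (intro mult_right_mono) (auto simp: C_def)
    finally show ?thesis .
  qed
  \<comment> \<open>The columns of the series, written as a recursion in the level.\<close>
  define f where "f i = rec_nat (T (basis (\<pi> 0 i))) (\<lambda>m y. T (basis (\<pi> (Suc m) i)) + R y)" for i
  have f_0: "f i 0 = T (basis (\<pi> 0 i))" and f_Suc: "f i (Suc m) = T (basis (\<pi> (Suc m) i)) + R (f i m)"
    for i m by (auto simp: f_def)
  have norm_R: "norm (R x) \<le> norm x" for x
    using norm_le_columns[OF R, of 1 x] \<pi>_surj R_\<pi> by (metis mult_1 norm_basis order_refl)
  have f_bound: "norm (f i m) \<le> C * (2 - (1/2) ^ m)" for i m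
  proof (induction m)
    case 0
    then show ?case using T_\<pi>[of 0 i] by (simp add: f_0)
  next
    case (Suc m)
    have "norm (f i (Suc m)) \<le> C * (1/2) ^ Suc m + C * (2 - (1/2) ^ m)"
      unfolding f_Suc using T_\<pi>[of "Suc m" i] norm_R[of "f i m"] Suc norm_triangle_ineq
      by (smt (verit))
    then show ?case by (simp add: algebra_simps)
  qed
  have C: "C \<ge> 0" using onorm_pos_le[OF bounded_clinear_imp_linear[OF T]] by (simp add: C_def)
  have f2: "norm (f i m) \<le> 2 * C" for i m
    using f_bound[of i m] C mult_left_mono[of "2 - (1/2) ^ m" 2 C] by simp
  define F where "F = cols (\<lambda>j. case coordinates j of (m, i) \<Rightarrow> f i m)"
  have F: "bounded_clinear F" and F_\<pi>: "F (basis (\<pi> m i)) = f i m" for m i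
    unfolding F_def using bounded_clinear_cols[of _ "2 * C"] cols_basis[of _ "2 * C"] f2
    by (simp_all add: coordinates split: prod.split)
  have LR: "L (R x) = x" for x
  proof (rule bounded_clinear_eqI[of "\<lambda>x. L (R x)" "\<lambda>x. x"])
    show "L (R (basis j)) = basis j" for j using \<pi>_surj[of j] by (auto simp: R_\<pi> L_Suc)
  qed (intro bclin_intros L[THEN bounded_clinear_comp] R)+
  have "T x = F x - R (F (L x))" for x
  proof (rule bounded_clinear_eqI[of T "\<lambda>x. F x - R (F (L x))"])
    show "T (basis j) = F (basis j) - R (F (L (basis j)))" for j
    proof -
      obtain m i where "j = \<pi> m i" using \<pi>_surj by blast
      then show ?thesis
        by (cases m) (simp_all add: F_\<pi> L_0 L_Suc f_0 f_Suc clin[OF F] clin[OF R])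
    qed
    show "bounded_clinear (\<lambda>x. F x - R (F (L x)))"
      by (intro bclin_intros F[THEN bounded_clinear_comp] R[THEN bounded_clinear_comp] F L)
  qed fact
  then show ?thesis
    unfolding commutator_def
    by (intro exI[of _ L] exI[of _ "\<lambda>x. R (F x)"]) (auto simp: L R F LR intro: bounded_clinear_comp)
qed

section \<open>Operator equations and block matrices\<close>

text \<open>The contraction principle in the Banach space of real-linear bounded operators, restricted to the
  closed subspace of the complex-linear ones. Both Sylvester equations and inverses of small
  perturbations of the identity are of this form.\<close>

lemma affine_operator_fixpoint:
  assumes L: "bounded_clinear L" and M: "bounded_clinear M" and A: "bounded_clinear A"
    and B: "bounded_clinear B" and c: "bounded_clinear c"
    and contr: "onorm L * onorm M + onorm A * onorm B < 1"
  shows "\<exists>X. bounded_clinear X \<and> (\<forall>x. X x = c x + L (X (M x)) + A (X (B x)))"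
proof -
  define Z where "Z = {X :: ell1 \<Rightarrow>\<^sub>L ell1. \<forall>z x. X (z *\<^sub>C x) = z *\<^sub>C X x}"
  have Z: "bounded_clinear (blinfun_apply X)" if "X \<in> Z" for X
    using that by (simp add: Z_def bounded_clinear_def blinfun.bounded_linear_right)
  define G where "G X = Blinfun (\<lambda>x. c x + L (blinfun_apply X (M x)) + A (blinfun_apply X (B x)))" for X
  have bcl: "bounded_clinear (\<lambda>x. c x + L (X (M x)) + A (X (B x)))" if "bounded_clinear X" for X
    by (intro bclin_intros c L[THEN bounded_clinear_comp] A[THEN bounded_clinear_comp]
        that[THEN bounded_clinear_comp] M B)
  have G: "blinfun_apply (G X) x = c x + L (X (M x)) + A (X (B x))" if "X \<in> Z" for X x
    unfolding G_def
    by (subst bounded_linear_Blinfun_apply[OF bounded_clinear_imp_linear[OF bcl[OF Z[OF that]]]]) simp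
  have nn: "onorm S \<ge> 0" if "bounded_clinear S" for S
    using that by (intro onorm_pos_le bounded_clinear_imp_linear)
  let ?r = "onorm L * onorm M + onorm A * onorm B"
  have sandwich: "norm (S (X (S' x))) \<le> onorm S * onorm S' * norm X * norm x"
    if "bounded_clinear S" "bounded_clinear S'" for S S' and X :: "ell1 \<Rightarrow>\<^sub>L ell1" and x
  proof -
    have "norm (S (X (S' x))) \<le> onorm S * norm (X (S' x))" by (rule bounded_clinear_onorm[OF that(1)])
    also have "\<dots> \<le> onorm S * (norm X * norm (S' x))"
      by (intro mult_left_mono norm_blinfun nn that)
    also have "\<dots> \<le> onorm S * (norm X * (onorm S' * norm x))"
      by (intro mult_left_mono bounded_clinear_onorm nn that norm_ge_zero)
    finally show ?thesis by (simp add: algebra_simps)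
  qed
  have "\<exists>!X\<in>Z. G X = X"
  proof (rule Banach_fix[of _ ?r])
    have "closed {X :: ell1 \<Rightarrow>\<^sub>L ell1. X (z *\<^sub>C x) = z *\<^sub>C X x}" for z x
      by (intro closed_Collect_eq bounded_linear.continuous_on[OF bounded_linear_scaleC]
          continuous_intros)
    then have "closed Z" unfolding Z_def by (intro closed_Collect_all)
    then show "complete Z" by (simp add: complete_eq_closed)
    show "Z \<noteq> {}" by (auto simp: Z_def intro!: exI[of _ 0])
    show "0 \<le> ?r" by (simp add: nn L M A B)
    show "?r < 1" by (rule contr)
    show "G ` Z \<subseteq> Z"
    proof clarify
      fix X assume X: "X \<in> Z"
      show "G X \<in> Z"
        using bcl[OF Z[OF X]] unfolding Z_def by (auto simp: G[OF X] bounded_clinear_def)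
    qed
    fix X Y assume X: "X \<in> Z" and Y: "Y \<in> Z"
    have "norm (blinfun_apply (G X - G Y) x) \<le> ?r * norm (X - Y) * norm x" for x
    proof -
      have "blinfun_apply (G X - G Y) x = L ((X - Y) (M x)) + A ((X - Y) (B x))"
        by (simp add: G X Y blinfun.diff_left clin[OF L] clin[OF A])
      then have "norm (blinfun_apply (G X - G Y) x)
          \<le> norm (L ((X - Y) (M x))) + norm (A ((X - Y) (B x)))" by (simp add: norm_triangle_ineq)
      also have "\<dots> \<le> onorm L * onorm M * norm (X - Y) * norm x + onorm A * onorm B * norm (X - Y) * norm x"
        by (intro add_mono sandwich L M A B)
      finally show ?thesis by (simp add: algebra_simps)
    qed
    then show "dist (G X) (G Y) \<le> ?r * dist X Y"
      unfolding dist_norm by (intro norm_blinfun_bound) (simp_all add: nn L M A B)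
  qed
  then obtain X where "X \<in> Z" "G X = X" by blast
  then show ?thesis using Z G by (intro exI[of _ "blinfun_apply X"]) metis
qed

text \<open>Dividing by \<open>\<kappa>\<close> turns the equation into a fixed point problem for a contraction.\<close>

lemma sylvester:
  fixes \<kappa> :: real
  assumes L: "bounded_clinear L" and M: "bounded_clinear M" and c: "bounded_clinear c"
    and \<kappa>: "onorm L + onorm M < \<bar>\<kappa>\<bar>"
  shows "\<exists>X. bounded_clinear X \<and> (\<forall>x. L (X x) - X (M x) + of_real \<kappa> *\<^sub>C X x = c x)"
proof -
  let ?k = "complex_of_real (1 / \<kappa>)"
  have nn: "onorm L \<ge> 0" "onorm M \<ge> 0"
    using L M by (auto intro: onorm_pos_le bounded_clinear_imp_linear)
  have k0: "\<kappa> \<noteq> 0" using \<kappa> nn by auto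
  have onorm_k: "onorm (\<lambda>x. (z * ?k) *\<^sub>C S x) \<le> onorm S / \<bar>\<kappa>\<bar>"
    if S: "bounded_clinear S" and z: "norm z = 1" for S z
  proof (rule onorm_bound)
    show "0 \<le> onorm S / \<bar>\<kappa>\<bar>" using S by (simp add: onorm_pos_le bounded_clinear_imp_linear)
    show "norm ((z * ?k) *\<^sub>C S x) \<le> onorm S / \<bar>\<kappa>\<bar> * norm x" for x
      using bounded_clinear_onorm[OF S, of x] z
      by (simp add: norm_scaleC norm_mult norm_divide divide_right_mono)
  qed
  have id1: "onorm (\<lambda>x::ell1. x) \<le> 1" by (rule onorm_bound) auto
  have "onorm (\<lambda>x. (- 1 * ?k) *\<^sub>C L x) * onorm (\<lambda>x::ell1. x) + onorm (\<lambda>x::ell1. x) * onorm (\<lambda>x. (1 * ?k) *\<^sub>C M x)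
     \<le> onorm L / \<bar>\<kappa>\<bar> * 1 + 1 * (onorm M / \<bar>\<kappa>\<bar>)"
    by (intro add_mono mult_mono onorm_k L M id1 onorm_pos_le bounded_clinear_imp_linear
        bclin_intros L[THEN bounded_clinear_comp] M[THEN bounded_clinear_comp]) (use nn in auto)
  also have "\<dots> < 1" using \<kappa> nn k0 by (simp add: divide_simps)
  finally have "\<exists>X. bounded_clinear X \<and> (\<forall>x. X x = ?k *\<^sub>C c x + (- 1 * ?k) *\<^sub>C L (X x) + X ((1 * ?k) *\<^sub>C M x))"
    by (intro affine_operator_fixpoint bclin_intros L M c)
  then obtain X where X: "bounded_clinear X"
    and eq: "\<And>x. X x = ?k *\<^sub>C c x + (- 1 * ?k) *\<^sub>C L (X x) + X ((1 * ?k) *\<^sub>C M x)" by blast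
  have "of_real \<kappa> *\<^sub>C X x = c x - L (X x) + X (M x)" for x
  proof -
    have "of_real \<kappa> *\<^sub>C X x = of_real \<kappa> *\<^sub>C (?k *\<^sub>C c x + (- 1 * ?k) *\<^sub>C L (X x) + X ((1 * ?k) *\<^sub>C M x))"
      using eq by simp
    then show ?thesis using k0 by (simp add: clin[OF X] scaleC_minus_left)
  qed
  then show ?thesis using X by (intro exI[of _ X]) simp
qed

lemma inverse_near_identity:
  assumes E: "bounded_clinear E" and E1: "onorm E < 1"
  obtains V where "bounded_clinear V" "\<And>x. V x + E (V x) = x" "\<And>x. V (x + E x) = x"
proof -
  have mE: "bounded_clinear (\<lambda>x. - E x)" by (intro bclin_intros E)
  have onorm_mE: "onorm (\<lambda>x. - E x) = onorm E" by (simp add: onorm_neg)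
  have id1: "onorm (\<lambda>x::ell1. x) \<le> 1" by (rule onorm_bound) auto
  have z: "onorm (\<lambda>x::ell1. 0 :: ell1) = 0" by (rule onorm_zero)
  have nn: "0 \<le> onorm E" using E by (simp add: onorm_pos_le bounded_clinear_imp_linear)
  have less: "onorm E * onorm (\<lambda>x::ell1. x) < 1"
    using mult_left_mono[OF id1 nn] E1 by simp
  obtain V where V: "bounded_clinear V" "\<And>x. V x = x + - E (V x)"
    using affine_operator_fixpoint[OF mE bounded_clinear_id bounded_clinear_zero bounded_clinear_zero
        bounded_clinear_id] less by (auto simp: onorm_mE z)
  obtain W where W: "bounded_clinear W" "\<And>x. W x = x + W (- E x)"
    using affine_operator_fixpoint[OF bounded_clinear_id mE bounded_clinear_zero bounded_clinear_zero
        bounded_clinear_id] less by (auto simp: onorm_mE z mult.commute)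
  have WE: "W (x + E x) = x" for x
    using W(2)[of x] by (simp add: clin[OF W(1)])
  have VE: "V x + E (V x) = x" for x using V(2)[of x] by (simp add: algebra_simps)
  have "W x = V x" for x using WE[of "V x"] VE[of x] by simp
  then show ?thesis using that V(1) VE WE by simp
qed

text \<open>A decomposition of the space into two subspaces, each identified with the whole space, so that
  the entries of the associated operator matrices act on the same space again.\<close>

locale splitting =
  fixes i\<^sub>1 i\<^sub>2 p\<^sub>1 p\<^sub>2 :: "ell1 \<Rightarrow> ell1"
  assumes bcl: "bounded_clinear i\<^sub>1" "bounded_clinear i\<^sub>2" "bounded_clinear p\<^sub>1" "bounded_clinear p\<^sub>2"
    and p_i [simp]: "p\<^sub>1 (i\<^sub>1 x) = x" "p\<^sub>2 (i\<^sub>2 x) = x" "p\<^sub>1 (i\<^sub>2 x) = 0" "p\<^sub>2 (i\<^sub>1 x) = 0"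
    and decomp: "i\<^sub>1 (p\<^sub>1 x) + i\<^sub>2 (p\<^sub>2 x) = x"
begin

lemmas bclI = bclin_intros bcl[THEN bounded_clinear_comp]
lemmas lin = clin[OF bcl(1)] clin[OF bcl(2)] clin[OF bcl(3)] clin[OF bcl(4)]

text \<open>
  Let the diagonal entries be the commutators of \<open>L\<close>, \<open>B\<^sub>1\<close> and of \<open>M\<close>, \<open>B\<^sub>2\<close>. Adding a scalar to \<open>M\<close> does
  not change the second commutator but makes the spectra of \<open>L\<close> and \<open>M\<close> disjoint. The diagonal matrix
  with entries \<open>L\<close>, \<open>M + \<kappa> I\<close> then has \<open>T\<close> as its commutator with a matrix whose off-diagonal entries
  \<open>X\<close>, \<open>Y\<close> solve two Sylvester equations.
\<close>

lemma commutator_diagonal: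
  assumes T: "bounded_clinear T"
    and c1: "commutator (\<lambda>x. p\<^sub>1 (T (i\<^sub>1 x)))" and c2: "commutator (\<lambda>x. p\<^sub>2 (T (i\<^sub>2 x)))"
  shows "commutator T"
proof -
  obtain L B\<^sub>1 where L: "bounded_clinear L" and B1: "bounded_clinear B\<^sub>1"
    and T11: "\<And>x. p\<^sub>1 (T (i\<^sub>1 x)) = L (B\<^sub>1 x) - B\<^sub>1 (L x)"
    using c1 unfolding commutator_def by metis
  obtain M B\<^sub>2 where M: "bounded_clinear M" and B2: "bounded_clinear B\<^sub>2"
    and T22: "\<And>x. p\<^sub>2 (T (i\<^sub>2 x)) = M (B\<^sub>2 x) - B\<^sub>2 (M x)"
    using c2 unfolding commutator_def by metis
  define \<kappa> where "\<kappa> = onorm L + onorm M + 1"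
  have nn: "onorm L \<ge> 0" "onorm M \<ge> 0"
    using L M by (auto intro: onorm_pos_le bounded_clinear_imp_linear)
  have bc12: "bounded_clinear (\<lambda>x. p\<^sub>1 (T (i\<^sub>2 x)))" and bc21: "bounded_clinear (\<lambda>x. p\<^sub>2 (T (i\<^sub>1 x)))"
    by (intro bclI bcl T[THEN bounded_clinear_comp])+
  have \<kappa>: "onorm L + onorm M < \<bar>- \<kappa>\<bar>" "onorm M + onorm L < \<bar>\<kappa>\<bar>" using nn by (auto simp: \<kappa>_def)
  obtain X where X: "bounded_clinear X"
    and X_eq: "\<And>x. L (X x) - X (M x) + of_real (- \<kappa>) *\<^sub>C X x = p\<^sub>1 (T (i\<^sub>2 x))"
    using sylvester[OF L M bc12 \<kappa>(1)] by metis
  obtain Y where Y: "bounded_clinear Y"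
    and Y_eq: "\<And>x. M (Y x) - Y (L x) + of_real \<kappa> *\<^sub>C Y x = p\<^sub>2 (T (i\<^sub>1 x))"
    using sylvester[OF M L bc21 \<kappa>(2)] by metis
  define P where "P x = i\<^sub>1 (L (p\<^sub>1 x)) + i\<^sub>2 (M (p\<^sub>2 x) + of_real \<kappa> *\<^sub>C p\<^sub>2 x)" for x
  define Q where "Q x = i\<^sub>1 (B\<^sub>1 (p\<^sub>1 x) + X (p\<^sub>2 x)) + i\<^sub>2 (Y (p\<^sub>1 x) + B\<^sub>2 (p\<^sub>2 x))" for x
  note bs = L[THEN bounded_clinear_comp] M[THEN bounded_clinear_comp] B1[THEN bounded_clinear_comp]
    B2[THEN bounded_clinear_comp] X[THEN bounded_clinear_comp] Y[THEN bounded_clinear_comp]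
  have P: "bounded_clinear P" unfolding P_def by (intro bclI bcl bs)
  have Q: "bounded_clinear Q" unfolding Q_def by (intro bclI bcl bs)
  have "T x = P (Q x) - Q (P x)" for x
  proof -
    define u where "u = p\<^sub>1 x"
    define v where "v = p\<^sub>2 x"
    have x: "x = i\<^sub>1 u + i\<^sub>2 v" by (simp add: u_def v_def decomp)
    have Tx: "T x = i\<^sub>1 (p\<^sub>1 (T x)) + i\<^sub>2 (p\<^sub>2 (T x))" by (simp add: decomp)
    have e1: "p\<^sub>1 (T x) = L (B\<^sub>1 u) - B\<^sub>1 (L u) + (L (X v) - X (M v) + of_real (- \<kappa>) *\<^sub>C X v)"
      using X_eq[of v] by (simp add: x clin[OF T] lin T11)
    have e2: "p\<^sub>2 (T x) = M (Y u) - Y (L u) + of_real \<kappa> *\<^sub>C Y u + (M (B\<^sub>2 v) - B\<^sub>2 (M v))"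
      by (simp add: x clin[OF T] lin T22 Y_eq)
    show ?thesis
      by (subst Tx, unfold e1 e2) (simp add: P_def Q_def x lin clin[OF L] clin[OF M] clin[OF B1] clin[OF B2] clin[OF X] clin[OF Y]
          scaleC_minus_left algebra_simps)
  qed
  then show ?thesis using P Q unfolding commutator_def by blast
qed

text \<open>
  Let \<open>C\<close>, \<open>D\<close> be the diagonal entries of \<open>T\<close> and \<open>V\<close> the lower left one. Conjugation by the block
  triangular \<open>I + i\<^sub>1 s p\<^sub>2\<close> changes the diagonal entries to \<open>C - s V\<close> and \<open>D + V s\<close>. The operator \<open>s\<close> is free,
  and \<open>V\<close> has the right inverse \<open>K\<close> that sends each \<open>basis n\<close> to \<open>basis (b n)\<close>. So the columns of \<open>s\<close> at even
  positions can be used to kill columns of \<open>D + V s\<close>, and those at odd positions to kill columns of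
  \<open>C - s V\<close>.
\<close>

lemma commutator_shift_corner:
  assumes T: "bounded_clinear T" and b: "inj b"
    and V: "\<And>n. p\<^sub>2 (T (i\<^sub>1 (basis (b n)))) = basis n"
  shows "commutator T"
proof -
  define C where "C x = p\<^sub>1 (T (i\<^sub>1 x))" for x
  define D where "D x = p\<^sub>2 (T (i\<^sub>2 x))" for x
  define K where "K = cols (\<lambda>n. basis (b n))"
  have K: "bounded_clinear K" and K_basis: "\<And>n. K (basis n) = basis (b n)"
    unfolding K_def by (auto intro!: bounded_clinear_cols[of _ 1] cols_basis[of _ 1])
  have C: "bounded_clinear C" and D: "bounded_clinear D"
    unfolding C_def D_def by (intro bclI bcl T[THEN bounded_clinear_comp])+
  have VK: "p\<^sub>2 (T (i\<^sub>1 (K x))) = x" for x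
    by (rule bounded_clinear_eqI[of "\<lambda>x. p\<^sub>2 (T (i\<^sub>1 (K x)))" "\<lambda>x. x"])
       (simp_all add: K_basis V bounded_clinear_id, intro bclI T[THEN bounded_clinear_comp] K)
  have KD: "bounded_clinear (\<lambda>x. K (D x))" by (rule bounded_clinear_comp[OF K D])
  define s where "s = cols (\<lambda>n. if even n then - K (D (basis n)) else C (basis (b n)))"
  have bound: "norm (if even n then - K (D (basis n)) else C (basis (b n)))
      \<le> onorm (\<lambda>x. K (D x)) + onorm C" for n
    using bounded_clinear_onorm[OF KD, of "basis n"] bounded_clinear_onorm[OF C, of "basis (b n)"]
      onorm_pos_le[OF bounded_clinear_imp_linear[OF KD]] onorm_pos_le[OF bounded_clinear_imp_linear[OF C]]
    by simp
  have s: "bounded_clinear s" and s_even: "even n \<Longrightarrow> s (basis n) = - K (D (basis n))"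
    and s_odd: "odd n \<Longrightarrow> s (basis n) = C (basis (b n))" for n
    unfolding s_def using bounded_clinear_cols[OF bound] cols_basis[OF bound] by auto
  define S where "S x = x + i\<^sub>1 (s (p\<^sub>2 x))" for x
  define S' where "S' x = x - i\<^sub>1 (s (p\<^sub>2 x))" for x
  have S: "bounded_clinear S" and S': "bounded_clinear S'"
    unfolding S_def S'_def by (intro bclI bcl s[THEN bounded_clinear_comp])+
  have inv: "S (S' x) = x" "S' (S x) = x" for x
    by (simp_all add: S_def S'_def lin clin[OF s])
  have T': "bounded_clinear (\<lambda>x. S' (T (S x)))"
    by (intro S'[THEN bounded_clinear_comp] T[THEN bounded_clinear_comp] S)
  have "commutator (\<lambda>x. p\<^sub>1 (S' (T (S (i\<^sub>1 x)))))"
  proof (rule commutator_null_columns[where a = "\<lambda>k. b (2 * k + 1)"])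
    show "bounded_clinear (\<lambda>x. p\<^sub>1 (S' (T (S (i\<^sub>1 x)))))"
      by (intro bclI bcl S'[THEN bounded_clinear_comp] T[THEN bounded_clinear_comp] S[THEN bounded_clinear_comp])
    show "inj (\<lambda>k. b (2 * k + 1))" using b by (auto dest!: injD intro!: injI)
    have "p\<^sub>1 (S' (T (S (i\<^sub>1 (basis (b (2 * k + 1))))))) = 0" for k
      using s_odd[of "2 * k + 1"] V[of "2 * k + 1"]
      by (simp add: S_def S'_def lin clin[OF s] C_def del: mult_Suc_right)
    then show "(\<lambda>k. norm (p\<^sub>1 (S' (T (S (i\<^sub>1 (basis (b (2 * k + 1))))))))) \<longlonglongrightarrow> 0" by simp
  qed
  moreover have "commutator (\<lambda>x. p\<^sub>2 (S' (T (S (i\<^sub>2 x)))))"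
  proof (rule commutator_null_columns[where a = "\<lambda>k. 2 * k"])
    show "bounded_clinear (\<lambda>x. p\<^sub>2 (S' (T (S (i\<^sub>2 x)))))"
      by (intro bclI bcl S'[THEN bounded_clinear_comp] T[THEN bounded_clinear_comp] S[THEN bounded_clinear_comp])
    show "inj (\<lambda>k::nat. 2 * k)" by (auto simp: inj_def)
    have "p\<^sub>2 (S' (T (S (i\<^sub>2 (basis (2 * k)))))) = 0" for k
      by (simp add: S_def S'_def lin clin[OF T] s_even VK D_def)
    then show "(\<lambda>k. norm (p\<^sub>2 (S' (T (S (i\<^sub>2 (basis (2 * k)))))))) \<longlonglongrightarrow> 0" by simp
  qed
  ultimately have "commutator (\<lambda>x. S' (T (S x)))" by (rule commutator_diagonal[OF T'])
  then show ?thesis by (rule commutator_similar[OF S S' inv T])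
qed

end

section \<open>Gliding humps\<close>

text \<open>
  Here \<open>\<Phi>\<close> is a coordinate map for the corner: \<open>\<Phi> T\<close> sends the vectors \<open>basis (b n)\<close> almost to the unit
  vectors, and the coordinates \<open>c n\<close> provide a section \<open>J\<close> of \<open>\<Phi>\<close>. The space splits into the kernel of
  \<open>\<Phi>\<close>, which contains the vectors \<open>basis (b n)\<close>, and the range of \<open>J\<close>. Composing with the inverse \<open>V\<close> of a
  small perturbation of the identity corrects the error.
\<close>

lemma commutator_biorthogonal:
  assumes T: "bounded_clinear T" and \<Phi>: "bounded_clinear \<Phi>"
    and b: "inj b" and c: "inj c" and bc: "range b \<inter> range c = {}"
    and \<Phi>_b: "\<And>n. \<Phi> (basis (b n)) = 0"
    and \<Phi>_c: "\<And>n. \<Phi> (basis (c n)) = \<alpha> n *\<^sub>C basis n" and \<alpha>: "0 < \<delta>" "\<And>n. \<delta> \<le> norm (\<alpha> n)"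
    and near: "r < 1" "\<And>n. norm (\<Phi> (T (basis (b n))) - basis n) \<le> r"
  shows "commutator T"
proof -
  define E where "E = cols (\<lambda>n. \<Phi> (T (basis (b n))) - basis n)"
  have E: "bounded_clinear E" and E_basis: "\<And>n. \<Phi> (T (basis (b n))) = basis n + E (basis n)"
    unfolding E_def using bounded_clinear_cols[OF near(2)] cols_basis[OF near(2)] by auto
  have "0 \<le> r" using near(2)[of 0] norm_ge_zero order_trans by blast
  then have "onorm E \<le> r"
    using near(2) by (intro onorm_bound norm_le_columns[OF E]) (simp_all add: E_basis)
  then obtain V where V: "bounded_clinear V" and V_inv: "\<And>x. V x + E (V x) = x" "\<And>x. V (x + E x) = x"
    using inverse_near_identity[OF E] near(1) by (metis le_less_trans)
  define J where "J = cols (\<lambda>n. (1 / \<alpha> n) *\<^sub>C basis (c n))"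
  have "norm ((1 / \<alpha> n) *\<^sub>C basis (c n)) \<le> 1 / \<delta>" for n
    using \<alpha>(1) \<alpha>(2)[of n] by (simp add: norm_scaleC norm_divide frac_le)
  then have J: "bounded_clinear J" and J_basis: "\<And>n. J (basis n) = (1 / \<alpha> n) *\<^sub>C basis (c n)"
    unfolding J_def by (auto intro: bounded_clinear_cols cols_basis)
  have \<alpha>0: "\<alpha> n \<noteq> 0" for n using \<alpha>(1) \<alpha>(2)[of n] by auto
  have \<Phi>J: "\<Phi> (J x) = x" for x
    by (rule bounded_clinear_eqI[of "\<lambda>x. \<Phi> (J x)" "\<lambda>x. x"])
       (simp_all add: J_basis clin[OF \<Phi>] \<Phi>_c \<alpha>0 bounded_clinear_id bounded_clinear_comp[OF \<Phi> J])
  \<comment> \<open>The complement of the coordinates \<open>c n\<close> parametrises the kernel of \<open>\<Phi>\<close>.\<close>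
  define W where "W = - range c"
  have b_W: "b n \<in> W" for n using bc by (auto simp: W_def)
  then have W: "infinite W" using range_inj_infinite[OF b] finite_subset[of "range b" W] by auto
  define y where "y = enumerate W"
  have y: "inj y" "range y = W"
    unfolding y_def using inj_enumerate[OF W] range_enumerate[OF W] by auto
  define K where "K = cols (\<lambda>n. basis (y n))"
  define \<rho> where "\<rho> = cols (\<lambda>j. if j \<in> W then basis (inv y j) else 0)"
  have K: "bounded_clinear K" and K_basis: "\<And>n. K (basis n) = basis (y n)"
    unfolding K_def using bounded_clinear_cols[of _ 1] cols_basis[of _ 1] by auto
  have \<rho>: "bounded_clinear \<rho>" and \<rho>_basis: "\<And>j. \<rho> (basis j) = (if j \<in> W then basis (inv y j) else 0)"
    unfolding \<rho>_def using bounded_clinear_cols[of _ 1] cols_basis[of _ 1] by auto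
  have y_inv: "y (inv y j) = j" if "j \<in> W" for j using that y(2) by (metis f_inv_into_f)
  have y_W: "y n \<in> W" for n using y(2) by auto
  have c_W: "c n \<notin> W" for n by (simp add: W_def)
  note comps = J[THEN bounded_clinear_comp] \<rho>[THEN bounded_clinear_comp] K[THEN bounded_clinear_comp]
    \<Phi>[THEN bounded_clinear_comp] V[THEN bounded_clinear_comp] E[THEN bounded_clinear_comp]
  have \<rho>J: "\<rho> (J x) = 0" for x
    by (rule bounded_clinear_eqI[of "\<lambda>x. \<rho> (J x)" "\<lambda>x. 0"])
       (simp_all add: J_basis \<rho>_basis c_W clin[OF \<rho>] bounded_clinear_zero bounded_clinear_comp[OF \<rho> J])
  have \<rho>K: "\<rho> (K x) = x" for x
    by (rule bounded_clinear_eqI[of "\<lambda>x. \<rho> (K x)" "\<lambda>x. x"])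
       (simp_all add: K_basis \<rho>_basis y_W inv_f_f[OF y(1)] bounded_clinear_id bounded_clinear_comp[OF \<rho> K])
  have decomp: "K (\<rho> x) - J (\<Phi> (K (\<rho> x))) + J (\<Phi> x) = x" for x
  proof (rule bounded_clinear_eqI[of "\<lambda>x. K (\<rho> x) - J (\<Phi> (K (\<rho> x))) + J (\<Phi> x)" "\<lambda>x. x"])
    show "K (\<rho> (basis j)) - J (\<Phi> (K (\<rho> (basis j)))) + J (\<Phi> (basis j)) = basis j" for j
    proof (cases "j \<in> W")
      case True
      then show ?thesis by (simp add: \<rho>_basis K_basis y_inv)
    next
      case False
      then obtain n where "j = c n" by (auto simp: W_def)
      then show ?thesis
        by (simp add: \<rho>_basis c_W clin[OF K] clin[OF J] clin[OF \<Phi>] \<Phi>_c J_basis \<alpha>0)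
    qed
  qed (intro bclin_intros comps \<rho> \<Phi>)+
  have VE: "V x + V (E x) = x" for x using V_inv(2)[of x] by (simp add: clin[OF V])
  interpret splitting "\<lambda>x. K x - J (\<Phi> (K x))" "\<lambda>x. J (x + E x)" \<rho> "\<lambda>x. V (\<Phi> x)"
  proof
    show "bounded_clinear (\<lambda>x. K x - J (\<Phi> (K x)))" "bounded_clinear (\<lambda>x. J (x + E x))"
      "bounded_clinear \<rho>" "bounded_clinear (\<lambda>x. V (\<Phi> x))"
      by (intro bclin_intros comps K E \<rho> \<Phi>)+
    show "K (\<rho> x) - J (\<Phi> (K (\<rho> x))) + J (V (\<Phi> x) + E (V (\<Phi> x))) = x" for x
      by (simp add: V_inv decomp)
  qed (simp_all add: \<Phi>J \<rho>J \<rho>K VE clin[OF V] clin[OF \<rho>] clin[OF \<Phi>])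
  show ?thesis
  proof (rule commutator_shift_corner[OF T])
    have yb: "y (inv y (b n)) = b n" for n by (rule y_inv[OF b_W])
    show "inj (\<lambda>n. inv y (b n))" by (intro injI) (metis injD[OF b] yb)
    show "V (\<Phi> (T (K (basis (inv y (b n))) - J (\<Phi> (K (basis (inv y (b n)))))))) = basis n" for n
      by (simp add: K_basis yb \<Phi>_b clin[OF J] E_basis V_inv)
  qed
qed

lemma mult_cnj_sgn: "z * cnj (sgn z) = of_real (norm z)"
proof (cases "z = 0")
  case False
  have "z * cnj (sgn z) = (z * cnj z) / of_real (norm z)" by (simp add: sgn_eq)
  also have "z * cnj z = of_real (norm z) * of_real (norm z)"
    using complex_norm_square[of z] by (simp add: power2_eq_square)
  also have "\<dots> / of_real (norm z) = of_real (norm z)" using False by simp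
  finally show ?thesis .
qed simp

text \<open>
  Coordinatewise convergence to \<open>0\<close> allows a subsequence \<open>b\<close> whose columns are, apart from the diagonal
  entry and an error of norm \<open>\<delta> / 4\<close>, supported in consecutive disjoint intervals from which
  all \<open>b n\<close> are removed. A hump may be spread thinly over its interval, so no single coordinate detects it; its
  norming functional does.
\<close>

lemma commutator_gliding_hump:
  assumes T: "bounded_clinear T" and a: "inj a"
    and null: "\<And>i. (\<lambda>k. coord (T (basis (a k))) i) \<longlonglongrightarrow> 0"
    and \<delta>: "0 < \<delta>" "\<And>k. \<delta> \<le> norm (restr (- {a k}) (T (basis (a k))))"
  shows "commutator T"
proof -
  have "\<exists>m>a k. norm (restr {m..} (T (basis (a k)))) < \<delta> / 8" for k
  proof -
    have "\<forall>\<^sub>F m in sequentially. norm (restr {m..} (T (basis (a k)))) < \<delta> / 8"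
      using \<delta>(1) by (intro order_tendstoD(2)[OF tail_tendsto_0]) simp
    from eventually_happens'[OF sequentially_bot eventually_conj[OF eventually_gt_at_top[of "a k"] this]]
    show ?thesis by blast
  qed
  then obtain M where M: "\<And>k. a k < M k" "\<And>k. norm (restr {M k..} (T (basis (a k)))) < \<delta> / 8"
    by metis
  have "\<forall>\<^sub>F y in sequentially. M x \<le> a y \<and> norm (restr {..<M x} (T (basis (a y)))) < \<delta> / 8" for x
  proof (rule eventually_conj)
    have "finite (a -` {..<M x})" by (rule finite_vimageI[OF _ a]) simp
    then show "\<forall>\<^sub>F y in sequentially. M x \<le> a y"
      by (simp add: cofinite_eq_sequentially[symmetric] eventually_cofinite vimage_def not_le)
    have lim: "(\<lambda>y. \<Sum>i<M x. norm (coord (T (basis (a y))) i)) \<longlonglongrightarrow> (\<Sum>i<M x. norm (0::complex))"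
      by (intro tendsto_intros null)
    show "\<forall>\<^sub>F y in sequentially. norm (restr {..<M x} (T (basis (a y)))) < \<delta> / 8"
      using order_tendstoD(2)[OF lim, of "\<delta> / 8"] \<delta>(1) by (simp add: norm_restr_finite)
  qed
  then obtain q where q: "strict_mono (q :: nat \<Rightarrow> nat)"
    and q_sep: "\<And>l n. l < n \<Longrightarrow> M (q l) \<le> a (q n) \<and> norm (restr {..<M (q l)} (T (basis (a (q n))))) < \<delta> / 8"
    using subsequence_pairwise[of "\<lambda>x y. M x \<le> a y \<and> norm (restr {..<M x} (T (basis (a y)))) < \<delta> / 8"]
    by auto
  define b where "b n = a (q n)" for n
  define m where "m n = M (q n)" for n
  define v where "v n = T (basis (b n))" for n
  have bm: "b n < m n" and tail: "norm (restr {m n..} (v n)) < \<delta> / 8" for n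
    using M by (auto simp: b_def m_def v_def)
  have mb: "m l \<le> b n" and head: "norm (restr {..<m l} (v n)) < \<delta> / 8" if "l < n" for l n
    using q_sep[OF that] by (auto simp: b_def m_def v_def)
  have m: "strict_mono m" using bm mb by (intro strict_monoI) (meson le_less_trans)
  \<comment> \<open>The number of the interval that contains \<open>i\<close>.\<close>
  define own where "own i = (LEAST n. i < m n)" for i
  have "i < m (Suc i)" for i
    using strict_mono_imp_increasing[OF m, of "Suc i"] by simp
  then have own: "i < m (own i)" for i unfolding own_def by (rule LeastI)
  have own_le: "m l \<le> i" if "l < own i" for l i using not_less_Least that by (fastforce simp: own_def)
  have own_b: "own (b n) = n" for n
    unfolding own_def using bm[of n] mb by (intro Least_equality) (auto, meson leD leI order_less_imp_le)
  define G where "G n = {i. own i = n \<and> i \<noteq> b n}" for n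
  have rest: "norm (restr {i. own i \<noteq> n} (v n)) \<le> \<delta> / 4" for n
  proof (cases n)
    case 0
    have "norm (restr {i. own i \<noteq> n} (v n)) \<le> norm (restr {m n..} (v n))"
      using own_le 0 by (intro norm_restr_mono) auto
    then show ?thesis using tail[of n] \<delta>(1) by simp
  next
    case (Suc n')
    have "{i. own i \<noteq> n} \<subseteq> {..<m n'} \<union> {m n..}"
    proof
      fix i assume "i \<in> {i. own i \<noteq> n}"
      then consider "own i \<le> n'" | "n < own i" using Suc by fastforce
      then show "i \<in> {..<m n'} \<union> {m n..}"
      proof cases
        case 1
        then have "m (own i) \<le> m n'" using m by (simp add: strict_mono_less_eq)
        then show ?thesis using own[of i] by simp
      next
        case 2
        then show ?thesis using own_le by simp
      qed
    qed
    then have "norm (restr {i. own i \<noteq> n} (v n)) \<le> norm (restr ({..<m n'} \<union> {m n..}) (v n))"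
      by (rule norm_restr_mono)
    also have "\<dots> \<le> norm (restr {..<m n'} (v n)) + norm (restr {m n..} (v n))"
      by (rule norm_restr_Un_le)
    finally show ?thesis using head[of n' n] tail[of n] Suc by simp
  qed
  define \<gamma> where "\<gamma> n = norm (restr (G n) (v n))" for n
  have \<gamma>_ge: "3 * \<delta> / 4 \<le> \<gamma> n" for n
  proof -
    have "- {b n} = G n \<union> {i. own i \<noteq> n}" using own_b by (auto simp: G_def)
    then have "\<delta> \<le> norm (restr (G n \<union> {i. own i \<noteq> n}) (v n))"
      using \<delta>(2)[of "q n"] by (simp add: b_def v_def)
    also have "\<dots> \<le> \<gamma> n + norm (restr {i. own i \<noteq> n} (v n))"
      unfolding \<gamma>_def by (rule norm_restr_Un_le)
    finally show ?thesis using rest[of n] by simp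
  qed
  have \<gamma>_pos: "\<gamma> n > 0" for n using \<gamma>_ge[of n] \<delta>(1) by simp
  have \<gamma>_le: "\<gamma> n \<le> onorm T" for n
    using norm_restr_le[of "G n" "v n"] bounded_clinear_onorm[OF T, of "basis (b n)"]
    by (simp add: \<gamma>_def v_def)
  have "\<exists>c\<in>G n. coord (v n) c \<noteq> 0" for n
  proof (rule ccontr)
    assume "\<not> ?thesis"
    then have "restr (G n) (v n) = 0" by (intro ell1_eqI) auto
    then show False using \<gamma>_pos[of n] by (simp add: \<gamma>_def)
  qed
  then obtain c where c: "\<And>n. c n \<in> G n" "\<And>n. coord (v n) (c n) \<noteq> 0" by metis
  have own_c: "own (c n) = n" "c n \<noteq> b n" for n using c(1) by (auto simp: G_def)
  \<comment> \<open>The norming functional of each hump, read off at the \<open>n\<close>-th coordinate.\<close>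
  define coeff where "coeff i = (if i = b (own i) then 0 else cnj (sgn (coord (v (own i)) i)) / of_real (\<gamma> (own i)))" for i
  define \<Phi> where "\<Phi> = cols (\<lambda>i. coeff i *\<^sub>C basis (own i))"
  have bound: "norm (coeff i *\<^sub>C basis (own i)) \<le> 4 / (3 * \<delta>)" for i
  proof -
    have "norm (coeff i) \<le> 1 / \<gamma> (own i)"
      using \<gamma>_pos[of "own i"] by (auto simp: coeff_def norm_divide norm_sgn divide_right_mono)
    also have "\<dots> \<le> 1 / (3 * \<delta> / 4)" using \<gamma>_ge \<delta>(1) by (intro divide_left_mono) (auto simp: \<gamma>_pos)
    finally show ?thesis by (simp add: norm_scaleC)
  qed
  have \<Phi>: "bounded_clinear \<Phi>" and \<Phi>_basis: "\<And>i. \<Phi> (basis i) = coeff i *\<^sub>C basis (own i)"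
    unfolding \<Phi>_def by (rule bounded_clinear_cols[OF bound], rule cols_basis[OF bound])
  have \<Phi>_hump: "\<Phi> (restr (G n) (v n)) = basis n" for n
  proof (rule ell1_eqI)
    fix k
    let ?x = "restr (G n) (v n)"
    have entry: "coord ?x j * coord (coeff j *\<^sub>C basis (own j)) k
        = of_real (if k = n then norm (coord ?x j) / \<gamma> n else 0)" for j
      by (auto simp: coeff_def G_def mult_cnj_sgn[symmetric])
    have "coord (\<Phi> ?x) k = (\<Sum>j. of_real (if k = n then norm (coord ?x j) / \<gamma> n else 0))"
      unfolding \<Phi>_def coord_cols[OF bound] entry ..
    also have "\<dots> = (if k = n then of_real (\<Sum>j. norm (coord ?x j) / \<gamma> n) else 0)"
      by (simp add: suminf_of_real[OF summable_divide[OF summable_coord[of ?x], of "\<gamma> n"]]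
          del: of_real_divide coord_restr)
    also have "(\<Sum>j. norm (coord ?x j) / \<gamma> n) = 1"
      using \<gamma>_pos[of n] by (simp add: suminf_divide summable_coord \<gamma>_def norm_eq_suminf del: coord_restr)
    finally show "coord (\<Phi> ?x) k = coord (basis n) k" by simp
  qed
  show ?thesis
  proof (rule commutator_biorthogonal[OF T \<Phi>, of b c "\<lambda>n. coeff (c n)" "1 / (onorm T + 1)" "1 / 3"])
    show "inj b" "inj c" by (rule inj_on_inverseI[of _ own], simp add: own_b own_c)+
    show "range b \<inter> range c = {}" 
    proof -
      have "b k \<noteq> c n" for k n using own_b[of k] own_c[of n] by auto
      then show ?thesis by auto
    qed
    show "\<Phi> (basis (b n)) = 0" for n by (simp add: \<Phi>_basis coeff_def own_b)
    show "\<Phi> (basis (c n)) = coeff (c n) *\<^sub>C basis n" for n by (simp add: \<Phi>_basis own_c)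
    show "1 / (onorm T + 1) \<le> norm (coeff (c n))" for n
      using \<gamma>_le[of n] \<gamma>_pos[of n] c(2)[of n] own_c[of n]
      by (simp add: coeff_def norm_divide norm_sgn frac_le)
    show "0 < 1 / (onorm T + 1)" using \<gamma>_le[of 0] \<gamma>_pos[of 0] by simp
    show "norm (\<Phi> (T (basis (b n))) - basis n) \<le> 1 / 3" for n
    proof -
      have "v n = restr {b n} (v n) + restr (G n) (v n) + restr {i. own i \<noteq> n} (v n)"
        by (rule ell1_eqI) (auto simp: G_def own_b)
      then have "\<Phi> (v n) = \<Phi> (restr {b n} (v n)) + \<Phi> (restr (G n) (v n)) + \<Phi> (restr {i. own i \<noteq> n} (v n))"
        by (metis clin(2)[OF \<Phi>])
      also have "\<Phi> (restr {b n} (v n)) = 0"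
        by (simp add: restr_singleton clin[OF \<Phi>] \<Phi>_basis coeff_def own_b)
      finally have "\<Phi> (v n) - basis n = \<Phi> (restr {i. own i \<noteq> n} (v n))" by (simp add: \<Phi>_hump)
      also have "norm \<dots> \<le> 4 / (3 * \<delta>) * norm (restr {i. own i \<noteq> n} (v n))"
        using bound by (intro norm_le_columns[OF \<Phi>]) (simp add: \<Phi>_basis)
      also have "\<dots> \<le> 4 / (3 * \<delta>) * (\<delta> / 4)"
        using rest \<delta>(1) by (intro mult_left_mono) auto
      finally show ?thesis using \<delta>(1) by (simp add: v_def)
    qed
  qed simp
qed

section \<open>Perturbed unit vectors\<close>

text \<open>
  The map \<open>N\<close> below sends \<open>basis (a k)\<close> to \<open>f k\<close> and has square \<open>0\<close>, since the \<open>f k\<close> vanish at all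
  \<open>a l\<close>. So \<open>I + N\<close> is invertible with inverse \<open>I - N\<close>, and up to this similarity the vectors
  \<open>basis (a k) + f k\<close> are as good as unit vectors.
\<close>

locale perturbed_units =
  fixes a :: "nat \<Rightarrow> nat" and f :: "nat \<Rightarrow> ell1" and C :: real
  assumes a: "inj a" and f_bound: "\<And>k. norm (f k) \<le> C"
    and f_a: "\<And>k l. coord (f k) (a l) = 0"
    and f_disjoint: "\<And>k l i. coord (f k) i \<noteq> 0 \<Longrightarrow> coord (f l) i \<noteq> 0 \<Longrightarrow> k = l"
begin

definition N :: "ell1 \<Rightarrow> ell1" where
  "N = cols (\<lambda>j. if j \<in> range a then f (inv a j) else 0)"

lemma column_bound: "norm (if j \<in> range a then f (inv a j) else 0) \<le> C"
  using f_bound order_trans[OF norm_ge_zero f_bound[of 0]] by auto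

lemma bounded_clinear_N: "bounded_clinear N"
  unfolding N_def by (rule bounded_clinear_cols[OF column_bound])

lemma N_basis: "N (basis j) = (if j \<in> range a then f (inv a j) else 0)"
  unfolding N_def by (rule cols_basis[OF column_bound])

lemma N_a: "N (basis (a k)) = f k"
  by (simp add: N_basis inv_f_f[OF a])

lemma coord_N: "coord (N x) i = (\<Sum>j. coord x j * coord (if j \<in> range a then f (inv a j) else 0) i)"
  unfolding N_def by (rule coord_cols[OF column_bound])

lemma N_f: "N (f k) = 0"
proof (rule ell1_eqI)
  have "coord (f k) j * coord (if j \<in> range a then f (inv a j) else 0) i = 0" for i j
    using f_a by auto
  then show "coord (N (f k)) i = coord 0 i" for i unfolding coord_N by (simp only: suminf_zero coord_simps)
qed

lemma N_N: "N (N x) = 0"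
proof (rule bounded_clinear_eqI[of "\<lambda>x. N (N x)" "\<lambda>x. 0"])
  show "N (N (basis j)) = 0" for j
    by (simp add: N_basis[of j] N_f clin[OF bounded_clinear_N])
qed (simp_all add: bounded_clinear_zero bounded_clinear_comp bounded_clinear_N)

text \<open>Disjointness of the supports makes \<open>N\<close> continuous for coordinatewise convergence.\<close>

lemma coord_N_single: "\<exists>j c. \<forall>x. coord (N x) i = coord x j * c"
proof (cases "\<exists>k. coord (f k) i \<noteq> 0")
  case True
  then obtain k where k: "coord (f k) i \<noteq> 0" by blast
  have "coord (N x) i = coord x (a k) * coord (f k) i" for x
  proof -
    have "(\<Sum>j. coord x j * coord (if j \<in> range a then f (inv a j) else 0) i)
        = (\<Sum>j\<in>{a k}. coord x j * coord (if j \<in> range a then f (inv a j) else 0) i)"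
      using f_disjoint[OF k] by (intro suminf_finite) (auto simp: inv_f_f[OF a])
    then show ?thesis by (simp add: coord_N inv_f_f[OF a])
  qed
  then show ?thesis by blast
next
  case False
  then have "coord x j * coord (if j \<in> range a then f (inv a j) else 0) i = 0" for x j by auto
  then have "coord (N x) i = coord x 0 * 0" for x unfolding coord_N by (simp only: suminf_zero mult_zero_right)
  then show ?thesis by blast
qed

lemma shear_bound: "norm (x + N x) \<le> (1 + C) * norm x" "norm (x - N x) \<le> (1 + C) * norm x"
proof -
  have "norm (N x) \<le> C * norm x"
    by (rule norm_le_columns[OF bounded_clinear_N]) (use column_bound in \<open>simp only: N_basis\<close>)
  then show "norm (x + N x) \<le> (1 + C) * norm x" "norm (x - N x) \<le> (1 + C) * norm x"
    using norm_triangle_ineq[of x "N x"] norm_triangle_ineq4[of x "N x"] by (auto simp: algebra_simps)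
qed

lemma bounded_clinear_shear: "bounded_clinear (\<lambda>x. x + N x)" "bounded_clinear (\<lambda>x. x - N x)"
  by (intro bclin_intros bounded_clinear_N)+

lemma shear_inverse: "(x - N x) + N (x - N x) = x" "(x + N x) - N (x + N x) = x"
  by (simp_all add: clin[OF bounded_clinear_N] N_N)

lemma commutator_null:
  assumes T: "bounded_clinear T" and null: "(\<lambda>k. norm (T (basis (a k) + f k))) \<longlonglongrightarrow> 0"
  shows "commutator T"
proof (rule commutator_similar[OF bounded_clinear_shear shear_inverse T], rule commutator_null_columns)
  show "bounded_clinear (\<lambda>x. T (x + N x) - N (T (x + N x)))"
    using bounded_clinear_comp[OF bounded_clinear_shear(2) bounded_clinear_comp[OF T bounded_clinear_shear(1)]] .
  show "inj a" by (rule a)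
  have lim: "(\<lambda>k. (1 + C) * norm (T (basis (a k) + f k))) \<longlonglongrightarrow> 0"
    by (rule tendsto_mult_right_zero[OF null])
  show "(\<lambda>k. norm (T (basis (a k) + N (basis (a k))) - N (T (basis (a k) + N (basis (a k)))))) \<longlonglongrightarrow> 0"
    unfolding N_a by (rule Lim_null_comparison[OF _ lim]) (simp add: shear_bound(2))
qed

text \<open>Subtracting \<open>\<mu>\<close> times the vectors themselves is harmless: the \<open>basis (a k)\<close> are coordinatewise null.
  Distances to the line through a vector change at most by the factor \<open>1 + C\<close> under the similarity.\<close>

lemma commutator_spread:
  assumes T: "bounded_clinear T"
    and null: "\<And>i. (\<lambda>k. coord (T (basis (a k) + f k) - \<mu> *\<^sub>C (basis (a k) + f k)) i) \<longlonglongrightarrow> 0"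
    and far: "0 < \<delta>" "\<And>k z. \<delta> \<le> norm (T (basis (a k) + f k) - z *\<^sub>C (basis (a k) + f k))"
  shows "commutator T"
proof (rule commutator_similar[OF bounded_clinear_shear shear_inverse T],
    rule commutator_gliding_hump[where \<delta> = "\<delta> / (1 + C)"])
  let ?T' = "\<lambda>x. T (x + N x) - N (T (x + N x))"
  show "bounded_clinear ?T'"
    using bounded_clinear_comp[OF bounded_clinear_shear(2) bounded_clinear_comp[OF T bounded_clinear_shear(1)]] .
  show "inj a" by (rule a)
  have C: "C \<ge> 0" using f_bound[of 0] norm_ge_zero order_trans by blast
  then show "0 < \<delta> / (1 + C)" using far by simp
  define w where "w z k = T (basis (a k) + f k) - z *\<^sub>C (basis (a k) + f k)" for z k
  have T'_w: "?T' (basis (a k)) - z *\<^sub>C basis (a k) = w z k - N (w z k)" for k z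
    by (simp add: N_a w_def clin[OF bounded_clinear_N] N_f)
  show "(\<lambda>k. coord (?T' (basis (a k))) i) \<longlonglongrightarrow> 0" for i
  proof -
    obtain j c where jc: "\<And>x. coord (N x) i = coord x j * c" using coord_N_single by metis
    have "coord (?T' (basis (a k))) i
        = (coord (w \<mu> k) i - coord (w \<mu> k) j * c) + \<mu> * coord (basis (a k)) i" for k
      using arg_cong[OF T'_w[of k \<mu>], of "\<lambda>x. coord x i"] by (simp add: jc algebra_simps del: coord_basis)
    moreover have "\<forall>\<^sub>F k in sequentially. coord (basis (a k)) i = 0"
    proof -
      have "finite (a -` {i})" by (rule finite_vimageI[OF _ a]) simp
      then show ?thesis
        by (simp add: cofinite_eq_sequentially[symmetric] eventually_cofinite vimage_def eq_commute[of i])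
    qed
    then have "(\<lambda>k. coord (basis (a k)) i) \<longlonglongrightarrow> 0" by (rule tendsto_eventually)
    then have "(\<lambda>k. (coord (w \<mu> k) i - coord (w \<mu> k) j * c) + \<mu> * coord (basis (a k)) i)
        \<longlonglongrightarrow> (0 - 0 * c) + \<mu> * 0"
      unfolding w_def by (intro tendsto_intros null)
    ultimately show ?thesis by simp
  qed
  show "\<delta> / (1 + C) \<le> norm (restr (- {a k}) (?T' (basis (a k))))" for k
  proof -
    let ?y = "restr (- {a k}) (?T' (basis (a k)))"
    define z where "z = coord (?T' (basis (a k))) (a k)"
    have "?y = ?T' (basis (a k)) - z *\<^sub>C basis (a k)"
      by (rule ell1_eqI) (auto simp: z_def)
    then have "?y = w z k - N (w z k)" by (simp only: T'_w)
    then have "w z k = ?y + N ?y" using shear_inverse(1) by simp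
    then have "\<delta> \<le> (1 + C) * norm ?y"
      using far(2)[of k z] shear_bound(1)[of ?y] by (simp add: w_def)
    then show ?thesis using C by (simp add: divide_le_eq mult.commute)
  qed
qed

end

section \<open>Differences of unit vectors\<close>

lemma difference_norm: "norm (basis i - basis j) \<le> 2"
  using norm_triangle_ineq4[of "basis i" "basis j"] by simp

lemma norm_add_diff_le: "norm (x + y - z) \<le> norm x + norm y + norm z"
  for x y z :: "'a :: real_normed_vector"
  using norm_triangle_ineq4[of "x + y" z] norm_triangle_ineq[of x y] by simp

text \<open>A noncompact operator has columns with tails bounded below arbitrarily far out. Along a
  subsequence these columns converge in each coordinate, and their tails glide away, which separates
  them from each other.\<close>

lemma noncompact_differences:
  assumes K: "bounded_clinear K" and nc: "\<not> compact_operator K"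
  obtains p :: "nat \<Rightarrow> nat" and \<eta> :: real where "inj p" "0 < \<eta>"
    and "\<And>k. \<eta> \<le> norm (K (basis (p (2 * k)) - basis (p (2 * k + 1))))"
    and "\<And>i. (\<lambda>k. coord (K (basis (p (2 * k)) - basis (p (2 * k + 1)))) i) \<longlonglongrightarrow> 0"
proof -
  define \<delta> where "\<delta> = ess_norm K / 2"
  have \<delta>: "0 < \<delta>"
    using nc ess_norm_nonneg[OF K] by (simp add: compact_operator_iff_ess_norm[OF K] \<delta>_def)
  have "\<exists>j. \<delta> < norm (restr {n..} (K (basis j)))" for n
  proof (rule ccontr)
    assume "\<not> ?thesis"
    then have "tail_norm K n \<le> \<delta>" by (intro tail_norm_le_columns[OF K]) (auto simp: not_less)
    moreover have "ess_norm K \<le> tail_norm K n"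
      by (rule decseq_ge[OF tail_norm_decseq[OF K] tail_norm_tendsto[OF K]])
    ultimately show False using \<delta> by (simp add: \<delta>_def)
  qed
  then obtain j where j: "\<And>n. \<delta> < norm (restr {n..} (K (basis (j n))))" by metis
  obtain s where s: "strict_mono (s :: nat \<Rightarrow> nat)"
    and conv: "\<And>i. \<exists>l. (\<lambda>n. coord (K (basis (j (s n)))) i) \<longlonglongrightarrow> l"
    using function_convergent_subsequence[of UNIV "\<lambda>n. coord (K (basis (j n)))" "onorm K"]
      order_trans[OF norm_coord_le bounded_clinear_onorm[OF K]]
    by (metis UNIV_I countableI_type mult.right_neutral norm_basis)
  have tail: "\<delta> < norm (restr {n..} (K (basis (j (s n)))))" for n
    using j[of "s n"] norm_restr_mono[of "{s n..}" "{n..}" "K (basis (j (s n)))"]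
      strict_mono_imp_increasing[OF s, of n] by force
  have ev: "\<forall>\<^sub>F y in sequentially. norm (restr {y..} (K (basis (j (s x))))) < \<delta> / 2" for x
    using \<delta> by (intro order_tendstoD(2)[OF tail_tendsto_0]) simp
  obtain t where t: "strict_mono (t :: nat \<Rightarrow> nat)"
    and small: "\<And>m n. m < n \<Longrightarrow> norm (restr {t n..} (K (basis (j (s (t m)))))) < \<delta> / 2"
    using subsequence_pairwise[of "\<lambda>x y. norm (restr {y..} (K (basis (j (s x))))) < \<delta> / 2", OF ev] by blast
  define p where "p n = j (s (t n))" for n
  have far: "\<delta> / 2 \<le> norm (K (basis (p m) - basis (p n)))" if "m < n" for m n
  proof -
    let ?x = "K (basis (p m) - basis (p n))"
    have "norm (restr {t n..} (K (basis (p n))))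
        \<le> norm (restr {t n..} (K (basis (p m)))) + norm (restr {t n..} ?x)"
      using norm_triangle_ineq4[of "restr {t n..} (K (basis (p m)))" "restr {t n..} ?x"]
      by (simp add: clin[OF K] clin[OF bounded_clinear_restr])
    then show ?thesis
      using tail[of "t n"] small[OF that] norm_restr_le[of "{t n..}" ?x] by (simp add: p_def)
  qed
  show ?thesis
  proof (rule that[of p "\<delta> / 2"])
    show "inj p"
    proof (rule linorder_injI)
      fix m n :: nat assume "m < n"
      then show "p m \<noteq> p n" using far[of m n] \<delta> by (auto simp: clin[OF K])
    qed
    show "0 < \<delta> / 2" using \<delta> by simp
    show "\<delta> / 2 \<le> norm (K (basis (p (2 * k)) - basis (p (2 * k + 1))))" for k by (rule far) simp
    show "(\<lambda>k. coord (K (basis (p (2 * k)) - basis (p (2 * k + 1)))) i) \<longlonglongrightarrow> 0" for i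
    proof -
      obtain l where l: "(\<lambda>n. coord (K (basis (j (s n)))) i) \<longlonglongrightarrow> l" using conv by blast
      have sm: "strict_mono (\<lambda>k::nat. t (2 * k))" "strict_mono (\<lambda>k::nat. t (2 * k + 1))"
        using t by (auto simp: strict_mono_def)
      have "(\<lambda>k. coord (K (basis (p (2 * k)))) i - coord (K (basis (p (2 * k + 1)))) i) \<longlonglongrightarrow> l - l"
        using LIMSEQ_subseq_LIMSEQ[OF l sm(1)] LIMSEQ_subseq_LIMSEQ[OF l sm(2)]
        by (intro tendsto_diff) (auto simp: p_def comp_def)
      then show ?thesis by (simp add: clin[OF K])
    qed
  qed
qed

text \<open>
  Write \<open>K = T - \<mu> I\<close>, let \<open>u\<close> run through the given differences and \<open>f\<close> through those on which \<open>K\<close> is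
  bounded below by \<open>\<eta>\<close>. For \<open>u\<close> far out relative to \<open>f\<close>, the vector \<open>K f\<close> is almost \<open>0\<close> at the leading
  coordinate of \<open>u\<close>, where \<open>u + f\<close> equals \<open>1\<close>. Hence \<open>K (u + f) - c (u + f)\<close> has norm almost \<open>norm c\<close> at
  least; it is also at least about \<open>\<eta> - 4 norm c\<close>, as \<open>u + f\<close> has norm at most \<open>4\<close>. The two bounds cannot
  both be small.
\<close>

lemma commutator_null_plus_noncompact:
  assumes T: "bounded_clinear T" and \<alpha>\<beta>: "\<And>k. \<alpha> k < \<beta> k" "\<And>k l. k < l \<Longrightarrow> \<beta> k < (\<alpha> l :: nat)"
    and null: "(\<lambda>k. norm (T (basis (\<alpha> k) - basis (\<beta> k)) - \<mu> *\<^sub>C (basis (\<alpha> k) - basis (\<beta> k)))) \<longlonglongrightarrow> 0"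
    and nc: "\<not> compact_operator (\<lambda>x. T x - \<mu> *\<^sub>C x)"
  shows "commutator T"
proof -
  define K where "K x = T x - \<mu> *\<^sub>C x" for x
  have K: "bounded_clinear K" unfolding K_def by (intro bclin_intros T)
  have nK: "\<not> compact_operator K" using nc by (simp add: K_def[abs_def])
  obtain p :: "nat \<Rightarrow> nat" and \<eta> :: real where p: "inj p" and \<eta>: "0 < \<eta>"
    and h_far: "\<And>k. \<eta> \<le> norm (K (basis (p (2 * k)) - basis (p (2 * k + 1))))"
    and h_null: "\<And>i. (\<lambda>k. coord (K (basis (p (2 * k)) - basis (p (2 * k + 1)))) i) \<longlonglongrightarrow> 0"
    by (rule noncompact_differences[OF K nK]) (rule that; assumption)
  define u where "u k = basis (\<alpha> k) - basis (\<beta> k)" for k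
  define f where "f k = basis (p (2 * k)) - basis (p (2 * k + 1))" for k
  have u_null: "(\<lambda>k. norm (K (u k))) \<longlonglongrightarrow> 0" using null by (simp add: K_def u_def)
  have \<alpha>_mono: "strict_mono \<alpha>" using \<alpha>\<beta> by (meson less_trans strict_monoI)
  have p_large: "\<forall>\<^sub>F y in sequentially. m < p y" for m
  proof -
    have "finite (p -` {..m})" by (rule finite_vimageI[OF _ p]) simp
    then show ?thesis
      by (simp add: cofinite_eq_sequentially[symmetric] eventually_cofinite vimage_def not_less)
  qed
  have \<alpha>_lim: "filterlim \<alpha> at_top sequentially" by (rule filterlim_subseq[OF \<alpha>_mono])
  have "\<forall>\<^sub>F y in sequentially. p (2 * k) < \<alpha> y \<and> p (2 * k + 1) < \<alpha> y \<and>
      norm (coord (K (f k)) (\<alpha> y)) < \<eta> / 16 \<and> norm (K (u y)) < \<eta> / 16 \<and> norm (K (u y)) < 1 / real (Suc k)" for k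
  proof (intro eventually_conj)
    show "\<forall>\<^sub>F y in sequentially. p (2 * k) < \<alpha> y" "\<forall>\<^sub>F y in sequentially. p (2 * k + 1) < \<alpha> y"
      by (rule eventually_compose_filterlim[OF eventually_gt_at_top \<alpha>_lim])+
    have "(\<lambda>y. norm (coord (K (f k)) (\<alpha> y))) \<longlonglongrightarrow> 0"
      using LIMSEQ_subseq_LIMSEQ[OF coord_tendsto_0 \<alpha>_mono]
      by (intro tendsto_norm_zero) (simp add: comp_def)
    then show "\<forall>\<^sub>F y in sequentially. norm (coord (K (f k)) (\<alpha> y)) < \<eta> / 16"
      using \<eta> by (intro order_tendstoD(2)) auto
    show "\<forall>\<^sub>F y in sequentially. norm (K (u y)) < \<eta> / 16"
      using \<eta> by (intro order_tendstoD(2)[OF u_null]) auto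
    show "\<forall>\<^sub>F y in sequentially. norm (K (u y)) < 1 / real (Suc k)"
      by (intro order_tendstoD(2)[OF u_null]) auto
  qed
  then obtain \<sigma> where "strict_mono (\<sigma> :: nat \<Rightarrow> nat)"
    and \<sigma>: "\<And>k. p (2 * k) < \<alpha> (\<sigma> k) \<and> p (2 * k + 1) < \<alpha> (\<sigma> k) \<and>
      norm (coord (K (f k)) (\<alpha> (\<sigma> k))) < \<eta> / 16 \<and> norm (K (u (\<sigma> k))) < \<eta> / 16 \<and>
      norm (K (u (\<sigma> k))) < 1 / real (Suc k)"
    using subsequence_diagonal[of "\<lambda>k y. p (2 * k) < \<alpha> y \<and> p (2 * k + 1) < \<alpha> y \<and>
      norm (coord (K (f k)) (\<alpha> y)) < \<eta> / 16 \<and> norm (K (u y)) < \<eta> / 16 \<and> norm (K (u y)) < 1 / real (Suc k)"]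
    by blast
  have sm: "strict_mono (\<lambda>k::nat. 2 * k)" "strict_mono (\<lambda>k::nat. 2 * k + 1)"
    by (auto simp: strict_mono_def)
  have "\<forall>\<^sub>F y in sequentially. \<beta> (\<sigma> x) < p (2 * y) \<and> \<beta> (\<sigma> x) < p (2 * y + 1)" for x
    by (intro eventually_conj eventually_subseq[OF sm(1) p_large] eventually_subseq[OF sm(2) p_large])
  then obtain \<tau> where \<tau>: "strict_mono (\<tau> :: nat \<Rightarrow> nat)"
    and sep: "\<And>x y. x < y \<Longrightarrow> \<beta> (\<sigma> (\<tau> x)) < p (2 * \<tau> y) \<and> \<beta> (\<sigma> (\<tau> x)) < p (2 * \<tau> y + 1)"
    using subsequence_pairwise[of "\<lambda>x y. \<beta> (\<sigma> x) < p (2 * y) \<and> \<beta> (\<sigma> x) < p (2 * y + 1)"] by blast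
  \<comment> \<open>Each block \<open>p (2 \<tau> k), p (2 \<tau> k + 1) < A k < B k\<close> lies entirely below the next one.\<close>
  define A where "A k = \<alpha> (\<sigma> (\<tau> k))" for k
  define B where "B k = \<beta> (\<sigma> (\<tau> k))" for k
  define P where "P k = p (2 * \<tau> k)" for k
  define Q where "Q k = p (2 * \<tau> k + 1)" for k
  have blk: "P k < A k" "Q k < A k" "A k < B k" "P k \<noteq> Q k" for k
    using \<sigma>[of "\<tau> k"] \<alpha>\<beta>(1)[of "\<sigma> (\<tau> k)"] by (auto simp: A_def B_def P_def Q_def inj_eq[OF p])
  have sepB: "B k < P l" "B k < Q l" if "k < l" for k l
    using sep[OF that] by (auto simp: B_def P_def Q_def)
  define g where "g k = f (\<tau> k) - basis (B k)" for k
  have g: "g k = basis (P k) - basis (Q k) - basis (B k)" for k by (simp add: g_def f_def P_def Q_def)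
  have lt: "x < y" if "k < l" "x \<in> {P k, Q k, A k, B k}" "y \<in> {P l, Q l, A l, B l}" for k l x y
    using that blk[of k] blk[of l] sepB[OF that(1)] by auto
  have disj: "k = l" if "x \<in> {P k, Q k, A k, B k}" "x \<in> {P l, Q l, A l, B l}" for k l x
    using lt that by (meson less_irrefl linorder_neqE_nat)
  interpret perturbed_units A g 3
  proof
    show "inj A"
    proof (rule injI)
      show "k = l" if "A k = A l" for k l using disj[of "A k" k l] that by simp
    qed
    show "norm (g k) \<le> 3" for k
      using norm_triangle_ineq4[of "basis (P k) - basis (Q k)" "basis (B k)"] difference_norm[of "P k" "Q k"]
      by (simp add: g)
    show "coord (g k) (A l) = 0" for k l
    proof (cases "k = l")
      case True
      then show ?thesis using blk[of k] by (auto simp: g)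
    next
      case False
      then show ?thesis using disj[of "A l" k l] by (auto simp: g)
    qed
    show "k = l" if "coord (g k) i \<noteq> 0" "coord (g l) i \<noteq> 0" for k l i
      using that disj[of i k l] by (auto simp: g split: if_splits)
  qed
  have unit: "basis (A k) + g k = u (\<sigma> (\<tau> k)) + f (\<tau> k)" for k
    by (simp add: u_def g_def A_def B_def)
  have residual: "T (basis (A k) + g k) - z *\<^sub>C (basis (A k) + g k)
      = K (u (\<sigma> (\<tau> k))) + K (f (\<tau> k)) - (z - \<mu>) *\<^sub>C (basis (A k) + g k)" for k z
    unfolding unit by (simp add: K_def clin[OF T] scaleC_diff_left algebra_simps)
  show ?thesis
  proof (rule commutator_spread[OF T, of \<mu> "\<eta> / 16"])
    show "(\<lambda>k. coord (T (basis (A k) + g k) - \<mu> *\<^sub>C (basis (A k) + g k)) i) \<longlonglongrightarrow> 0" for i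
    proof -
      have "(\<lambda>k. K (u (\<sigma> k))) \<longlonglongrightarrow> 0"
        using \<sigma> by (intro LIMSEQ_norm_0) simp
      then have "(\<lambda>k. K (u (\<sigma> (\<tau> k)))) \<longlonglongrightarrow> 0"
        using LIMSEQ_subseq_LIMSEQ[OF _ \<tau>] by (simp add: comp_def)
      then have "(\<lambda>k. coord (K (u (\<sigma> (\<tau> k)))) i) \<longlonglongrightarrow> coord 0 i"
        by (rule bounded_linear.tendsto[OF bounded_linear_coord])
      moreover have "(\<lambda>k. coord (K (f (\<tau> k))) i) \<longlonglongrightarrow> 0"
        using LIMSEQ_subseq_LIMSEQ[OF h_null \<tau>] by (simp add: comp_def f_def)
      ultimately have "(\<lambda>k. coord (K (u (\<sigma> (\<tau> k)))) i + coord (K (f (\<tau> k))) i) \<longlonglongrightarrow> coord 0 i + 0"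
        by (rule tendsto_add)
      then show ?thesis unfolding residual by simp
    qed
    show "0 < \<eta> / 16" using \<eta> by simp
    show "\<eta> / 16 \<le> norm (T (basis (A k) + g k) - z *\<^sub>C (basis (A k) + g k))" for k z
    proof -
      \<comment> \<open>With \<open>r = norm R\<close> and \<open>c = norm (z - \<mu>)\<close>: \<open>c \<le> \<eta> / 8 + r\<close> and \<open>\<eta> \<le> r + 4 c + \<eta> / 16\<close>, so that \<open>5 r \<ge> 7 \<eta> / 16\<close>.\<close>
      define R where "R = K (u (\<sigma> (\<tau> k))) + K (f (\<tau> k)) - (z - \<mu>) *\<^sub>C (basis (A k) + g k)"
      have \<sigma>k: "norm (K (u (\<sigma> (\<tau> k)))) < \<eta> / 16" "norm (coord (K (f (\<tau> k))) (A k)) < \<eta> / 16"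
        using \<sigma>[of "\<tau> k"] by (simp_all add: A_def)
      have "z - \<mu> = coord (K (u (\<sigma> (\<tau> k)))) (A k) + coord (K (f (\<tau> k))) (A k) - coord R (A k)"
        by (simp add: R_def f_a)
      then have "norm (z - \<mu>) \<le> norm (coord (K (u (\<sigma> (\<tau> k)))) (A k))
          + norm (coord (K (f (\<tau> k))) (A k)) + norm (coord R (A k))"
        by (simp only: norm_add_diff_le)
      also have "\<dots> \<le> \<eta> / 16 + \<eta> / 16 + norm R"
        using \<sigma>k norm_coord_le[of "K (u (\<sigma> (\<tau> k)))" "A k"] norm_coord_le[of R "A k"] by linarith
      finally have c: "norm (z - \<mu>) \<le> \<eta> / 8 + norm R" by simp
      have "K (f (\<tau> k)) = R + (z - \<mu>) *\<^sub>C (basis (A k) + g k) - K (u (\<sigma> (\<tau> k)))"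
        by (simp add: R_def)
      then have "norm (K (f (\<tau> k))) \<le> norm R + norm ((z - \<mu>) *\<^sub>C (basis (A k) + g k)) + norm (K (u (\<sigma> (\<tau> k))))"
        by (simp only: norm_add_diff_le)
      moreover have "norm (basis (A k) + g k) \<le> 4"
        using norm_triangle_ineq[of "basis (A k)" "g k"] f_bound[of k] by simp
      then have "norm ((z - \<mu>) *\<^sub>C (basis (A k) + g k)) \<le> norm (z - \<mu>) * 4"
        unfolding norm_scaleC by (intro mult_left_mono) auto
      moreover have "\<eta> \<le> norm (K (f (\<tau> k)))" using h_far[of "\<tau> k"] by (simp add: f_def)
      ultimately have "\<eta> / 16 \<le> norm R" using \<sigma>k c \<eta> by linarith
      then show ?thesis unfolding residual R_def .
    qed
  qed
qed

section \<open>The characterisation\<close>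

lemma coordinatewise_null_differences:
  assumes T: "bounded_clinear T"
  obtains \<alpha> \<beta> :: "nat \<Rightarrow> nat" where "\<And>k. \<alpha> k < \<beta> k" "\<And>k l. k < l \<Longrightarrow> \<beta> k < \<alpha> l"
    and "\<And>i. (\<lambda>k. coord (T (basis (\<alpha> k) - basis (\<beta> k))) i) \<longlonglongrightarrow> 0"
proof -
  obtain s where s: "strict_mono (s :: nat \<Rightarrow> nat)"
    and conv: "\<And>i. \<exists>l. (\<lambda>n. coord (T (basis (s n))) i) \<longlonglongrightarrow> l"
    using function_convergent_subsequence[of UNIV "\<lambda>n. coord (T (basis n))" "onorm T"]
      order_trans[OF norm_coord_le bounded_clinear_onorm[OF T]]
    by (metis UNIV_I countableI_type mult.right_neutral norm_basis)
  show ?thesis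
  proof (rule that[of "\<lambda>k. s (2 * k)" "\<lambda>k. s (2 * k + 1)"])
    fix i
    obtain l where l: "(\<lambda>n. coord (T (basis (s n))) i) \<longlonglongrightarrow> l" using conv by blast
    have sm: "strict_mono (\<lambda>k::nat. 2 * k)" "strict_mono (\<lambda>k::nat. 2 * k + 1)"
      by (auto simp: strict_mono_def)
    have "(\<lambda>k. coord (T (basis (s (2 * k)))) i - coord (T (basis (s (2 * k + 1)))) i) \<longlonglongrightarrow> l - l"
      using LIMSEQ_subseq_LIMSEQ[OF l sm(1)] LIMSEQ_subseq_LIMSEQ[OF l sm(2)]
      by (intro tendsto_diff) (auto simp: comp_def)
    then show "(\<lambda>k. coord (T (basis (s (2 * k)) - basis (s (2 * k + 1)))) i) \<longlonglongrightarrow> 0"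
      by (simp add: clin[OF T])
  qed (use s in \<open>auto simp: strict_mono_less\<close>)
qed

lemma perturbed_units_differences:
  assumes "\<And>k. \<alpha> k < \<beta> k" "\<And>k l. k < l \<Longrightarrow> \<beta> k < (\<alpha> l :: nat)"
  shows "perturbed_units \<alpha> (\<lambda>k. - basis (\<beta> k)) 1"
proof
  have lt: "\<alpha> k < \<alpha> l \<and> \<alpha> k < \<beta> l \<and> \<beta> k < \<alpha> l \<and> \<beta> k < \<beta> l" if "k < l" for k l
    using assms(1)[of k] assms(1)[of l] assms(2)[OF that] by simp
  show "inj \<alpha>" using lt by (intro linorder_injI) (simp add: less_imp_neq)
  show "coord (- basis (\<beta> k)) (\<alpha> l) = 0" for k l
    using lt[of k l] lt[of l k] assms(1)[of k] by (cases k l rule: linorder_cases) auto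
  show "k = l" if "coord (- basis (\<beta> k)) i \<noteq> 0" "coord (- basis (\<beta> l)) i \<noteq> 0" for k l i
    using that lt[of k l] lt[of l k] by (cases k l rule: linorder_cases) (auto split: if_splits)
qed simp

text \<open>The vectors \<open>T u\<close> either stay away from the lines through \<open>u\<close>, or the approximate eigenvalues have a
  limit point \<open>\<mu>\<close>; in that case the hypothesis, if \<open>\<mu> \<noteq> 0\<close>, is applied to \<open>c = \<mu>\<close>.\<close>

lemma noncompact_imp_commutator:
  assumes T: "bounded_clinear T" and nc: "\<And>c. c \<noteq> 0 \<Longrightarrow> \<not> compact_operator (\<lambda>x. T x - c *\<^sub>C x)"
  shows "commutator T"
proof -
  obtain \<alpha> \<beta> :: "nat \<Rightarrow> nat" where \<alpha>\<beta>: "\<And>k. \<alpha> k < \<beta> k" "\<And>k l. k < l \<Longrightarrow> \<beta> k < \<alpha> l"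
    and null: "\<And>i. (\<lambda>k. coord (T (basis (\<alpha> k) - basis (\<beta> k))) i) \<longlonglongrightarrow> 0"
    by (rule coordinatewise_null_differences[OF T]) (rule that; assumption)
  define u where "u k = basis (\<alpha> k) - basis (\<beta> k)" for k
  have sub: "perturbed_units (\<lambda>k. \<alpha> (s k)) (\<lambda>k. - basis (\<beta> (s k))) 1" if "strict_mono s" for s
    using \<alpha>\<beta> that by (intro perturbed_units_differences) (auto simp: strict_mono_less)
  show ?thesis
  proof (cases "\<exists>\<delta>>0. infinite {k. \<forall>z. \<delta> \<le> norm (T (u k) - z *\<^sub>C u k)}")
    case True
    then obtain \<delta> where \<delta>: "\<delta> > 0" and inf: "infinite {k. \<forall>z. \<delta> \<le> norm (T (u k) - z *\<^sub>C u k)}" by blast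
    then obtain s where s: "strict_mono (s :: nat \<Rightarrow> nat)" and far: "\<And>k z. \<delta> \<le> norm (T (u (s k)) - z *\<^sub>C u (s k))"
      using infinite_enumerate[OF inf] by auto
    interpret perturbed_units "\<lambda>k. \<alpha> (s k)" "\<lambda>k. - basis (\<beta> (s k))" 1 by (rule sub[OF s])
    show ?thesis
    proof (rule commutator_spread[OF T, of 0 \<delta>])
      show "(\<lambda>k. coord (T (basis (\<alpha> (s k)) + - basis (\<beta> (s k))) - 0 *\<^sub>C (basis (\<alpha> (s k)) + - basis (\<beta> (s k)))) i) \<longlonglongrightarrow> 0" for i
        using LIMSEQ_subseq_LIMSEQ[OF null s, of i] by (simp add: comp_def)
      show "\<delta> \<le> norm (T (basis (\<alpha> (s k)) + - basis (\<beta> (s k))) - z *\<^sub>C (basis (\<alpha> (s k)) + - basis (\<beta> (s k))))" for k z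
        using far[of k z] by (simp add: u_def)
    qed fact
  next
    case False
    have "\<forall>\<^sub>F y in sequentially. \<exists>z. norm (T (u y) - z *\<^sub>C u y) < 1 / real (Suc k)" for k
    proof -
      have "finite {y. \<forall>z. 1 / real (Suc k) \<le> norm (T (u y) - z *\<^sub>C u y)}"
        using False by (auto simp del: of_nat_Suc)
      then show ?thesis
        by (simp add: cofinite_eq_sequentially[symmetric] eventually_cofinite not_less del: of_nat_Suc)
    qed
    then obtain s where s: "strict_mono (s :: nat \<Rightarrow> nat)"
      and "\<And>k. \<exists>z. norm (T (u (s k)) - z *\<^sub>C u (s k)) < 1 / real (Suc k)"
      using subsequence_diagonal[of "\<lambda>k y. \<exists>z. norm (T (u y) - z *\<^sub>C u y) < 1 / real (Suc k)"] by auto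
    then obtain z where z: "\<And>k. norm (T (u (s k)) - z k *\<^sub>C u (s k)) < 1 / real (Suc k)" by metis
    have u2: "norm (u k) \<le> 2" for k by (simp add: u_def difference_norm)
    have z_bound: "norm (z k) \<le> onorm T * 2 + 1" for k
    proof -
      have "coord (u (s k)) (\<alpha> (s k)) = 1" using \<alpha>\<beta>(1)[of "s k"] by (simp add: u_def)
      then have "norm (z k) = norm (coord (z k *\<^sub>C u (s k)) (\<alpha> (s k)))" by simp
      also have "\<dots> \<le> norm (z k *\<^sub>C u (s k))" by (rule norm_coord_le)
      also have "\<dots> \<le> norm (T (u (s k))) + norm (T (u (s k)) - z k *\<^sub>C u (s k))"
        using norm_triangle_ineq4[of "T (u (s k))" "T (u (s k)) - z k *\<^sub>C u (s k)"] by simp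
      also have "\<dots> \<le> onorm T * 2 + 1"
      proof (rule add_mono)
        have "norm (T (u (s k))) \<le> onorm T * norm (u (s k))" by (rule bounded_clinear_onorm[OF T])
        also have "\<dots> \<le> onorm T * 2"
          using u2 T by (intro mult_left_mono onorm_pos_le bounded_clinear_imp_linear)
        finally show "norm (T (u (s k))) \<le> onorm T * 2" .
        have "1 / real (Suc k) \<le> 1" by simp
        then show "norm (T (u (s k)) - z k *\<^sub>C u (s k)) \<le> 1" using z[of k] by linarith
      qed
      finally show ?thesis .
    qed
    then have "bounded (range z)" unfolding bounded_iff by blast
    then obtain \<mu> t where t: "strict_mono (t :: nat \<Rightarrow> nat)" and \<mu>: "(z \<circ> t) \<longlonglongrightarrow> \<mu>"
      using bounded_imp_convergent_subsequence by metis
    define r where "r k = s (t k)" for k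
    have r: "strict_mono r" using s t by (simp add: r_def strict_mono_def)
    have lim: "(\<lambda>k. norm (T (u (r k)) - \<mu> *\<^sub>C u (r k))) \<longlonglongrightarrow> 0"
    proof (rule Lim_null_comparison)
      show "\<forall>\<^sub>F k in sequentially. norm (norm (T (u (r k)) - \<mu> *\<^sub>C u (r k)))
          \<le> 1 / real (Suc (t k)) + norm (z (t k) - \<mu>) * 2"
      proof (rule always_eventually, rule allI)
        fix k
        have "T (u (r k)) - \<mu> *\<^sub>C u (r k) = (T (u (r k)) - z (t k) *\<^sub>C u (r k)) + (z (t k) - \<mu>) *\<^sub>C u (r k)"
          by (simp add: scaleC_diff_left)
        then have "norm (T (u (r k)) - \<mu> *\<^sub>C u (r k))
            \<le> norm (T (u (r k)) - z (t k) *\<^sub>C u (r k)) + norm ((z (t k) - \<mu>) *\<^sub>C u (r k))"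
          by (metis norm_triangle_ineq)
        also have "\<dots> \<le> 1 / real (Suc (t k)) + norm (z (t k) - \<mu>) * 2"
          using z[of "t k"] mult_left_mono[OF u2[of "r k"], of "norm (z (t k) - \<mu>)"]
          by (simp add: r_def norm_scaleC del: of_nat_Suc)
        finally show "norm (norm (T (u (r k)) - \<mu> *\<^sub>C u (r k)))
            \<le> 1 / real (Suc (t k)) + norm (z (t k) - \<mu>) * 2" by simp
      qed
      have "(\<lambda>k. 1 / real (Suc (t k))) \<longlonglongrightarrow> 0"
        using LIMSEQ_subseq_LIMSEQ[OF LIMSEQ_inverse_real_of_nat t] by (simp add: comp_def inverse_eq_divide)
      moreover have "(\<lambda>k. norm (z (t k) - \<mu>)) \<longlonglongrightarrow> 0"
        using \<mu> by (intro tendsto_norm_zero) (simp add: LIM_zero_iff comp_def)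
      ultimately have "(\<lambda>k. 1 / real (Suc (t k)) + norm (z (t k) - \<mu>) * 2) \<longlonglongrightarrow> 0 + 0 * 2"
        by (intro tendsto_intros)
      then show "(\<lambda>k. 1 / real (Suc (t k)) + norm (z (t k) - \<mu>) * 2) \<longlonglongrightarrow> 0" by simp
    qed
    show ?thesis
    proof (cases "\<mu> = 0")
      case True
      interpret perturbed_units "\<lambda>k. \<alpha> (r k)" "\<lambda>k. - basis (\<beta> (r k))" 1 by (rule sub[OF r])
      show ?thesis using lim True by (intro commutator_null[OF T]) (simp add: u_def)
    next
      case False
      show ?thesis
      proof (rule commutator_null_plus_noncompact[OF T, of "\<lambda>k. \<alpha> (r k)" "\<lambda>k. \<beta> (r k)" \<mu>])
        show "\<not> compact_operator (\<lambda>x. T x - \<mu> *\<^sub>C x)" by (rule nc[OF False])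
      qed (use \<alpha>\<beta> r lim in \<open>auto simp: u_def strict_mono_less\<close>)
    qed
  qed
qed

theorem theorem4p6:
  fixes T :: "ell1 \<Rightarrow> ell1"
  assumes "bounded_clinear T"
  shows "commutator T \<longleftrightarrow>
    (\<forall>c::complex. c \<noteq> 0 \<longrightarrow> \<not> compact_operator (\<lambda>x. T x - c *\<^sub>C x))"
proof
  assume "commutator T"
  then obtain A B where A: "bounded_clinear A" and B: "bounded_clinear B"
    and T: "T = (\<lambda>x. A (B x) - B (A x))" unfolding commutator_def by blast
  show "\<forall>c. c \<noteq> 0 \<longrightarrow> \<not> compact_operator (\<lambda>x. T x - c *\<^sub>C x)"
  proof (intro allI impI)
    fix c :: complex assume "c \<noteq> 0"
    have "bounded_clinear (\<lambda>x. T x - c *\<^sub>C x)" by (intro bclin_intros assms)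
    then show "\<not> compact_operator (\<lambda>x. T x - c *\<^sub>C x)"
      using commutator_ess_norm_pos[OF A B \<open>c \<noteq> 0\<close>] by (simp add: compact_operator_iff_ess_norm T)
  qed
qed (use noncompact_imp_commutator[OF assms] in blast)

end
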